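(* Let $\nu>0$, $L>0$, $t>0$, and let $f$ be a smooth $L$-periodic vector field with zero spatial mean. Let $u$ be a smooth $L$-periodic solution on $\mathbb{R}^3\times[0,t]$ of the Navier–Stokes equations $$\partial_tu+u\cdot\nabla u-\nu\Delta u+\nabla p=f,\qquad\nabla\cdot u=0.$$ Let $\ell$ be the smooth $L$-periodic solution of $(\partial_t+u\cdot\nabla-\nu\Delta)\ell+u=0$ with $\ell(x,0)=0$, and put $A(x,t)=x+\ell(x,t)$. For $\delta_0>0$ define the pair dispersion $$\langle\delta_t^2\rangle=L^{-6}\iint_{\{(x,y)\in([0,L]^3)^2:\ |A(x,t)-A(y,t)|\le\delta_0\}}|x-y|^2\,dxdy.$$ Then $$\langle\delta_t^2\rangle\le3\delta_0^2+24E_0t^2+6\epsilon_Bt^3,$$ where $E_0=\frac1{2L^3}\int_{[0,L]^3}|u(x,0)|^2dx$ and $\epsilon_B=\frac1{\nu t}\int_0^tL^{-3}\int_{[0,L]^3}|(-\Delta)^{-1/2}f(x,s)|^2dxds$.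
   Context: $(-\Delta)^{-1/2}$ is defined on mean-zero $L$-periodic functions via Fourier series. *)

theory Defs
  imports "HOL-Analysis.Analysis"
begin

fun Cn_on :: "nat \<Rightarrow> 'a::real_normed_vector set \<Rightarrow> ('a \<Rightarrow> 'b::real_normed_vector) \<Rightarrow> bool" where
  "Cn_on 0 S g = continuous_on S g"
| "Cn_on (Suc n) S g = (\<exists>g'. (\<forall>z\<in>S. (g has_derivative g' z) (at z within S)) \<and>
                              (\<forall>v. Cn_on n S (\<lambda>z. g' z v)))"

definition smooth_on :: "'a::real_normed_vector set \<Rightarrow> ('a \<Rightarrow> 'b::real_normed_vector) \<Rightarrow> bool" where
  "smooth_on S g \<longleftrightarrow> (\<forall>n. Cn_on n S g)"

definition cell :: "real \<Rightarrow> (real^3) set" where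
  "cell L = cbox 0 (\<chi> i. L)"

definition periodic_st :: "real \<Rightarrow> (real^3 \<Rightarrow> real \<Rightarrow> 'b) \<Rightarrow> bool" where
  "periodic_st L g \<longleftrightarrow> (\<forall>x s i. g (x + L *\<^sub>R axis i 1) s = g x s)"

definition pd :: "3 \<Rightarrow> (real^3 \<Rightarrow> 'b::real_normed_vector) \<Rightarrow> real^3 \<Rightarrow> 'b" where
  "pd i g x = vector_derivative (\<lambda>h. g (x + h *\<^sub>R axis i 1)) (at 0)"

definition grad :: "(real^3 \<Rightarrow> real) \<Rightarrow> real^3 \<Rightarrow> real^3" where
  "grad g x = (\<chi> i. pd i g x)"

definition divg :: "(real^3 \<Rightarrow> real^3) \<Rightarrow> real^3 \<Rightarrow> real" where
  "divg v x = (\<Sum>i\<in>UNIV. pd i (\<lambda>y. v y $ i) x)"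

definition lap :: "(real^3 \<Rightarrow> 'b::real_normed_vector) \<Rightarrow> real^3 \<Rightarrow> 'b" where
  "lap g x = (\<Sum>i\<in>UNIV. pd i (pd i g) x)"

definition adv :: "(real^3 \<Rightarrow> real^3) \<Rightarrow> (real^3 \<Rightarrow> 'b::real_normed_vector) \<Rightarrow> real^3 \<Rightarrow> 'b" where
  "adv v g x = (\<Sum>i\<in>UNIV. (v x $ i) *\<^sub>R pd i g x)"

definition dt :: "real \<Rightarrow> (real^3 \<Rightarrow> real \<Rightarrow> 'b::real_normed_vector) \<Rightarrow> real^3 \<Rightarrow> real \<Rightarrow> 'b" where
  "dt T g x s = vector_derivative (\<lambda>\<tau>. g x \<tau>) (at s within {0..T})"

definition kdot :: "int^3 \<Rightarrow> real^3 \<Rightarrow> real" where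
  "kdot k x = (\<Sum>i\<in>UNIV. of_int (k $ i) * x $ i)"

definition knorm :: "int^3 \<Rightarrow> real" where
  "knorm k = sqrt (\<Sum>i\<in>UNIV. (of_int (k $ i))^2)"

definition fcoef :: "real \<Rightarrow> (real^3 \<Rightarrow> real) \<Rightarrow> int^3 \<Rightarrow> complex" where
  "fcoef L h k = complex_of_real (1 / L^3) *
      integral (cell L) (\<lambda>x. complex_of_real (h x) * cis (- 2 * pi * kdot k x / L))"

(* (-Delta)^{-1/2} on mean-zero L-periodic fields, componentwise via Fourier series:
   symbol |2 pi k / L|^{-1} on k \<noteq> 0 *)
definition inv_sqrt_neg_lap :: "real \<Rightarrow> (real^3 \<Rightarrow> real^3) \<Rightarrow> real^3 \<Rightarrow> real^3" where
  "inv_sqrt_neg_lap L g x = (\<chi> j. Re (\<Sum>\<^sub>\<infinity>k\<in>UNIV - {0}.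
      complex_of_real (L / (2 * pi * knorm k)) * fcoef L (\<lambda>y. g y $ j) k * cis (2 * pi * kdot k x / L)))"

definition pair_dispersion :: "real \<Rightarrow> real \<Rightarrow> (real^3 \<Rightarrow> real^3) \<Rightarrow> real" where
  "pair_dispersion L \<delta>0 A = (1 / L^6) *
     integral {z :: (real^3) \<times> (real^3). fst z \<in> cell L \<and> snd z \<in> cell L \<and> norm (A (fst z) - A (snd z)) \<le> \<delta>0}
       (\<lambda>z. (norm (fst z - snd z))^2)"

end

theory Submission
  imports Defs
begin

text \<open>
  Writing \<open>x - y = (A x - A y) - (ell x - ell y)\<close>, the dispersion is at most \<open>3 \<delta>0\<^sup>2\<close> plus six times the
  mean of \<open>|ell|\<^sup>2\<close> at time \<open>T\<close>. In the energy identity for \<open>u\<close>, the work of the force is bounded by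
  \<open>\<parallel>(-\<Delta>)\<^bsup>-1/2\<^esup> f\<parallel> \<parallel>\<nabla>u\<parallel>\<close> and absorbed into the dissipation, which bounds the energy of \<open>u\<close> on
  \<open>[0, T]\<close> by a constant \<open>M\<close>. The energy identity for \<open>ell\<close> then gives \<open>V' \<le> T M + V / T\<close> for the energy \<open>V\<close>
  of \<open>ell\<close>, hence \<open>V T \<le> (e - 1) T\<^sup>2 M \<le> 2 T\<^sup>2 M\<close>. The duality step uses only the mean-square density
  of finite Fourier sums (from Stone--Weierstrass on the torus) and Bessel's inequality for the two factors.
\<close>

subsection \<open>Smooth functions on space-time\<close>

text \<open>The operator \<open>inv_sqrt_neg_lap\<close> is given as a pointwise infinite series, so
  nothing can be said about its values before convergence is known. The smoothness of
  \<open>f\<close> is therefore spent on decay of its Fourier coefficients, uniformly in time. This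
  yields joint continuity of the image, makes its coefficients readable term by term, and makes the
  time integral of its energy differentiable, which the comparison argument for \<open>u\<close>
  requires. All spatial integrations by parts rest on one fact: translating a periodic function
  leaves its cell integral unchanged, so the integral of a partial derivative is the derivative of a
  constant. The two uses of Young's inequality have forced weights: \<open>\<nu>\<close> to match
  the dissipation, and the time scale \<open>T\<close> for \<open>ell\<close>, so that the growth
  rate is \<open>1 / T\<close> and the growth factor over the whole interval is the number e. With
  \<open>M = U 0 + 1 / (2 * \<nu>) * integral {0..T} G\<close>, where \<open>U\<close> and
  \<open>G\<close> are unnormalised energies of \<open>u\<close> and of the image of
  \<open>f\<close>, the product of the factors 6 and 2 gives 12 times each term of \<open>M\<close>.
  The factor 1/2 in the kinetic energy turns the first 12 into 24, and the 1/2 in \<open>M\<close>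
  turns the second into 6.\<close>

lemma Cn_on_cong:
  assumes "Cn_on n S g" "\<And>z. z \<in> S \<Longrightarrow> g z = h z"
  shows "Cn_on n S h"
proof (cases n)
  case 0
  then show ?thesis using assms continuous_on_cong[of S S g h] by simp
next
  case (Suc m)
  then obtain g' where g': "\<forall>z\<in>S. (g has_derivative g' z) (at z within S)" "\<forall>v. Cn_on m S (\<lambda>z. g' z v)"
    using assms(1) by auto
  have "(h has_derivative g' z) (at z within S)" if "z \<in> S" for z
    using has_derivative_transform[OF that _ g'(1)[rule_format, OF that], of h] assms(2) by metis
  then show ?thesis using Suc g'(2) by auto
qed

lemma Cn_on_bounded_linear:
  assumes "bounded_linear F"
  shows "Cn_on n S g \<Longrightarrow> Cn_on n S (\<lambda>z. F (g z))"
proof (induction n arbitrary: g)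
  case 0
  then show ?case using bounded_linear.continuous_on[OF assms] by simp
next
  case (Suc n)
  then obtain g' where g': "\<forall>z\<in>S. (g has_derivative g' z) (at z within S)" "\<forall>v. Cn_on n S (\<lambda>z. g' z v)"
    by auto
  show ?case
    unfolding Cn_on.simps
    by (rule exI[of _ "\<lambda>z v. F (g' z v)"])
       (use bounded_linear.has_derivative[OF assms g'(1)[rule_format]] g'(2) Suc.IH in blast)
qed

lemma Cn_on_add: "Cn_on n S g \<Longrightarrow> Cn_on n S h \<Longrightarrow> Cn_on n S (\<lambda>z. g z + h z)"
proof (induction n arbitrary: g h)
  case 0
  then show ?case by (simp add: continuous_on_add)
next
  case (Suc n)
  then obtain g' h' where "\<forall>z\<in>S. (g has_derivative g' z) (at z within S)" "\<forall>v. Cn_on n S (\<lambda>z. g' z v)"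
    "\<forall>z\<in>S. (h has_derivative h' z) (at z within S)" "\<forall>v. Cn_on n S (\<lambda>z. h' z v)"
    by auto
  then show ?case using Suc.IH
    by (auto intro!: exI[of _ "\<lambda>z v. g' z v + h' z v"] has_derivative_add)
qed

definition smooth_st :: "real \<Rightarrow> (real^3 \<Rightarrow> real \<Rightarrow> 'b::real_normed_vector) \<Rightarrow> bool" where
  "smooth_st T G \<longleftrightarrow> smooth_on (UNIV \<times> {0..T}) (\<lambda>z. G (fst z) (snd z))"

lemma smooth_st_bounded_linear:
  "bounded_linear F \<Longrightarrow> smooth_st T G \<Longrightarrow> smooth_st T (\<lambda>x s. F (G x s))"
  unfolding smooth_st_def smooth_on_def using Cn_on_bounded_linear by fast

lemma smooth_st_add:
  "smooth_st T G \<Longrightarrow> smooth_st T H \<Longrightarrow> smooth_st T (\<lambda>x s. G x s + H x s)"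
  by (auto simp: smooth_st_def smooth_on_def intro!: Cn_on_add)

lemma smooth_st_nth: "smooth_st T G \<Longrightarrow> smooth_st T (\<lambda>x s. G x s $ (j::'n::finite))"
  for G :: "real^3 \<Rightarrow> real \<Rightarrow> real^'n"
  by (rule smooth_st_bounded_linear[OF bounded_linear_vec_nth])

lemma smooth_st_continuous:
  assumes "smooth_st T G"
  shows "continuous_on (UNIV \<times> {0..T}) (\<lambda>(x, s). G x s)"
proof -
  have "Cn_on 0 (UNIV \<times> {0..T}) (\<lambda>z. G (fst z) (snd z))"
    using assms by (simp only: smooth_st_def smooth_on_def)
  then show ?thesis by (simp add: split_beta)
qed

lemma smooth_st_continuous_slice:
  assumes "smooth_st T G" "s \<in> {0..T}"
  shows "continuous_on A (\<lambda>x. G x s)"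
proof -
  have "continuous_on A (\<lambda>x. case (x, s) of (x, s) \<Rightarrow> G x s)"
    by (rule continuous_on_compose2[OF smooth_st_continuous[OF assms(1)]])
       (use assms(2) in \<open>auto intro!: continuous_intros\<close>)
  then show ?thesis by simp
qed

text \<open>The slab is unbounded in space, so a spatial line through a point of it never leaves it:
  a derivative within the slab becomes a two-sided one, even at the initial and final times. Lines
  in the time direction, treated next, keep the restriction to \<open>{0..T}\<close>.\<close>

lemma has_vector_derivative_line_x:
  fixes G :: "real^3 \<Rightarrow> real \<Rightarrow> 'b::real_normed_vector"
  assumes "((\<lambda>z. G (fst z) (snd z)) has_derivative D) (at (x, s) within UNIV \<times> {0..T})" "s \<in> {0..T}"
  shows "((\<lambda>h. G (x + h *\<^sub>R axis i 1) s) has_vector_derivative D (axis i 1, 0)) (at 0)"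
proof -
  have 1: "((\<lambda>h::real. (x + h *\<^sub>R axis i (1::real), s)) has_vector_derivative (axis i 1, 0)) (at 0)"
  proof -
    have "((\<lambda>h::real. (x + h *\<^sub>R axis i (1::real), s)) has_derivative (\<lambda>h. (0 + h *\<^sub>R axis i 1, 0))) (at 0)"
      by (intro derivative_intros)
    then show ?thesis by (simp add: has_vector_derivative_def)
  qed
  have 2: "((\<lambda>z. G (fst z) (snd z)) has_derivative D) (at ((\<lambda>h::real. (x + h *\<^sub>R axis i (1::real), s)) 0)
            within (\<lambda>h::real. (x + h *\<^sub>R axis i (1::real), s)) ` UNIV)"
    by (rule has_derivative_subset[where s="UNIV \<times> {0..T}"]) (use assms in auto)
  show ?thesis
    using vector_derivative_diff_chain_within[OF 1 2] by (simp add: o_def)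
qed

lemma has_vector_derivative_line_t:
  fixes G :: "real^3 \<Rightarrow> real \<Rightarrow> 'b::real_normed_vector"
  assumes "((\<lambda>z. G (fst z) (snd z)) has_derivative D) (at (x, s) within UNIV \<times> {0..T})"
  shows "((\<lambda>\<tau>. G x \<tau>) has_vector_derivative D (0, 1)) (at s within {0..T})"
proof -
  have 1: "((\<lambda>\<tau>::real. (x, \<tau>)) has_vector_derivative (0, 1)) (at s within {0..T})"
  proof -
    have "((\<lambda>\<tau>::real. (x, \<tau>)) has_derivative (\<lambda>h. (0, h))) (at s within {0..T})"
      by (intro derivative_intros)
    then show ?thesis by (simp add: has_vector_derivative_def)
  qed
  have 2: "((\<lambda>z. G (fst z) (snd z)) has_derivative D) (at ((\<lambda>\<tau>. (x, \<tau>)) s) within (\<lambda>\<tau>::real. (x, \<tau>)) ` {0..T})"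
    by (rule has_derivative_subset[where s="UNIV \<times> {0..T}"]) (use assms in auto)
  show ?thesis
    using vector_derivative_diff_chain_within[OF 1 2] by (simp add: o_def)
qed

text \<open>\<open>Cn_on\<close> hides derivatives behind existential quantifiers, so the
  \<open>D\<close> obtained here may depend on \<open>n\<close>. Its values in the coordinate
  directions are nevertheless forced to be \<open>pd\<close> and \<open>dt\<close>, and this is how
  smoothness passes to these concrete derivatives. For \<open>dt\<close> uniqueness requires every
  \<open>s\<close>, endpoints included, to be a limit point of \<open>{0..T}\<close>, whence
  \<open>T > 0\<close>.\<close>

lemma smooth_st_deriv:
  fixes G :: "real^3 \<Rightarrow> real \<Rightarrow> 'b::real_normed_vector"
  assumes "smooth_st T G" "T > 0"
  shows "\<exists>D. (\<forall>x. \<forall>s\<in>{0..T}.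
        ((\<lambda>z. G (fst z) (snd z)) has_derivative D (x, s)) (at (x, s) within UNIV \<times> {0..T}) \<and>
        (\<forall>i. D (x, s) (axis i 1, 0) = pd i (\<lambda>y. G y s) x) \<and> D (x, s) (0, 1) = dt T G x s) \<and>
      (\<forall>v. Cn_on n (UNIV \<times> {0..T}) (\<lambda>z. D z v))"
proof -
  have "Cn_on (Suc n) (UNIV \<times> {0..T}) (\<lambda>z. G (fst z) (snd z))"
    using assms(1) by (simp only: smooth_st_def smooth_on_def)
  then obtain D where D: "\<forall>z\<in>UNIV \<times> {0..T}. ((\<lambda>z. G (fst z) (snd z)) has_derivative D z) (at z within UNIV \<times> {0..T})"
    "\<forall>v. Cn_on n (UNIV \<times> {0..T}) (\<lambda>z. D z v)" by auto
  show ?thesis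
  proof (intro exI[of _ D] conjI allI ballI)
    fix x s assume s: "s \<in> {0..T}"
    show *: "((\<lambda>z. G (fst z) (snd z)) has_derivative D (x, s)) (at (x, s) within UNIV \<times> {0..T})"
      using D(1) s by auto
    show "D (x, s) (axis i 1, 0) = pd i (\<lambda>y. G y s) x" for i
      unfolding pd_def using vector_derivative_at[OF has_vector_derivative_line_x[OF * s]] by simp
    show "D (x, s) (0, 1) = dt T G x s"
      unfolding dt_def
      by (rule vector_derivative_within[symmetric, OF _ has_vector_derivative_line_t[OF *]])
         (use assms(2) s islimpt_Icc in \<open>simp add: trivial_limit_within\<close>)
  qed (use D(2) in auto)
qed

lemma smooth_st_pd:
  assumes "smooth_st T G" "T > 0"
  shows "smooth_st T (\<lambda>x s. pd i (\<lambda>y. G y s) x)"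
  unfolding smooth_st_def smooth_on_def
proof
  fix n
  obtain D where D: "\<forall>x. \<forall>s\<in>{0..T}.
        ((\<lambda>z. G (fst z) (snd z)) has_derivative D (x, s)) (at (x, s) within UNIV \<times> {0..T}) \<and>
        (\<forall>i. D (x, s) (axis i 1, 0) = pd i (\<lambda>y. G y s) x) \<and> D (x, s) (0, 1) = dt T G x s"
      "\<forall>v. Cn_on n (UNIV \<times> {0..T}) (\<lambda>z. D z v)"
    using smooth_st_deriv[OF assms(1,2), of n] by blast
  show "Cn_on n (UNIV \<times> {0..T}) (\<lambda>z. pd i (\<lambda>y. G y (snd z)) (fst z))"
    by (rule Cn_on_cong[OF D(2)[rule_format, of "(axis i 1, 0)"]]) (use D(1) in auto)
qed

lemma smooth_st_dt:
  assumes "smooth_st T G" "T > 0"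
  shows "smooth_st T (dt T G)"
  unfolding smooth_st_def smooth_on_def
proof
  fix n
  obtain D where D: "\<forall>x. \<forall>s\<in>{0..T}.
        ((\<lambda>z. G (fst z) (snd z)) has_derivative D (x, s)) (at (x, s) within UNIV \<times> {0..T}) \<and>
        (\<forall>i. D (x, s) (axis i 1, 0) = pd i (\<lambda>y. G y s) x) \<and> D (x, s) (0, 1) = dt T G x s"
      "\<forall>v. Cn_on n (UNIV \<times> {0..T}) (\<lambda>z. D z v)"
    using smooth_st_deriv[OF assms(1,2), of n] by blast
  show "Cn_on n (UNIV \<times> {0..T}) (\<lambda>z. dt T G (fst z) (snd z))"
    by (rule Cn_on_cong[OF D(2)[rule_format, of "(0, 1)"]]) (use D(1) in auto)
qed

lemma smooth_st_has_pd:
  assumes "smooth_st T G" "T > 0" "s \<in> {0..T}"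
  shows "((\<lambda>h. G (x + h *\<^sub>R axis i 1) s) has_vector_derivative pd i (\<lambda>y. G y s) x) (at 0)"
proof -
  obtain D where D: "\<forall>x. \<forall>s\<in>{0..T}.
        ((\<lambda>z. G (fst z) (snd z)) has_derivative D (x, s)) (at (x, s) within UNIV \<times> {0..T}) \<and>
        (\<forall>i. D (x, s) (axis i 1, 0) = pd i (\<lambda>y. G y s) x) \<and> D (x, s) (0, 1) = dt T G x s"
      "\<forall>v. Cn_on 0 (UNIV \<times> {0..T}) (\<lambda>z. D z v)"
    using smooth_st_deriv[OF assms(1,2), of 0] by blast
  show ?thesis
    using has_vector_derivative_line_x[of G "D (x, s)" x s T i] D(1) assms(3) by simp
qed

lemma smooth_st_has_dt:
  assumes "smooth_st T G" "T > 0" "s \<in> {0..T}"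
  shows "((\<lambda>\<tau>. G x \<tau>) has_vector_derivative dt T G x s) (at s within {0..T})"
proof -
  obtain D where D: "\<forall>x. \<forall>s\<in>{0..T}.
        ((\<lambda>z. G (fst z) (snd z)) has_derivative D (x, s)) (at (x, s) within UNIV \<times> {0..T}) \<and>
        (\<forall>i. D (x, s) (axis i 1, 0) = pd i (\<lambda>y. G y s) x) \<and> D (x, s) (0, 1) = dt T G x s"
      "\<forall>v. Cn_on 0 (UNIV \<times> {0..T}) (\<lambda>z. D z v)"
    using smooth_st_deriv[OF assms(1,2), of 0] by blast
  show ?thesis
    using has_vector_derivative_line_t[of G "D (x, s)" x s T] D(1) assms(3) by simp
qed

lemma pd_nth:
  fixes G :: "real^3 \<Rightarrow> real \<Rightarrow> real^3"
  assumes "smooth_st T G" "T > 0" "s \<in> {0..T}"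
  shows "pd i (\<lambda>y. G y s $ j) x = pd i (\<lambda>y. G y s) x $ j"
  unfolding pd_def[of i "\<lambda>y. G y s $ j"]
  by (rule vector_derivative_at)
     (rule bounded_linear.has_vector_derivative[OF bounded_linear_vec_nth smooth_st_has_pd[OF assms]])

lemma periodic_st_pd:
  assumes "periodic_st L G"
  shows "periodic_st L (\<lambda>x s. pd i (\<lambda>y. G y s) x)"
  unfolding periodic_st_def
proof (intro allI)
  fix x :: "real^3" and s and j :: 3
  have "(\<lambda>h. G (x + L *\<^sub>R axis j 1 + h *\<^sub>R axis i 1) s) = (\<lambda>h. G (x + h *\<^sub>R axis i 1) s)"
  proof
    fix h
    have "x + L *\<^sub>R axis j 1 + h *\<^sub>R axis i 1 = x + h *\<^sub>R axis i 1 + L *\<^sub>R axis j 1" by simp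
    then show "G (x + L *\<^sub>R axis j 1 + h *\<^sub>R axis i 1) s = G (x + h *\<^sub>R axis i 1) s"
      using assms unfolding periodic_st_def by metis
  qed
  then show "pd i (\<lambda>y. G y s) (x + L *\<^sub>R axis j 1) = pd i (\<lambda>y. G y s) x"
    by (simp add: pd_def)
qed

subsection \<open>Integrals over the period cell\<close>

lemma cell_mem: "x \<in> cell L \<longleftrightarrow> (\<forall>i. 0 \<le> x $ i \<and> x $ i \<le> L)"
  by (simp add: cell_def mem_box_cart)

lemma content_cell: "L \<ge> 0 \<Longrightarrow> measure lborel (cell L) = L ^ 3"
  unfolding cell_def by (subst content_cbox_cart) (auto simp: interval_eq_empty_cart)

lemma integrable_on_cell:
  fixes h :: "real^3 \<Rightarrow> 'b::banach"
  shows "continuous_on UNIV h \<Longrightarrow> h integrable_on cell L"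
  unfolding cell_def by (rule integrable_continuous) (rule continuous_on_subset, auto)

text \<open>The box obtained by lengthening the cell by \<open>t\<close> in direction
  \<open>i\<close> is cut in two ways. A cut at height \<open>L\<close> gives the cell and a slab
  that periodicity carries back to \<open>P\<close>; a cut at height \<open>t\<close> gives
  \<open>P\<close> and the translated cell. Cancelling the integral over \<open>P\<close> leaves the
  claim.\<close>

lemma integral_cell_translate:
  fixes h :: "real^3 \<Rightarrow> 'b::banach"
  assumes cont: "continuous_on UNIV h" and per: "\<And>x. h (x + L *\<^sub>R axis i 1) = h x"
    and t: "0 \<le> t" "t \<le> L"
  shows "integral (cell L) (\<lambda>x. h (x + t *\<^sub>R axis i 1)) = integral (cell L) h"
proof -
  define b :: "real^3" where "b = (\<chi> i. L)"
  define e :: "real^3" where "e = axis i 1"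
  define P :: "(real^3) set" where "P = cbox 0 (\<chi> j. if j = i then t else L)"
  have int: "h integrable_on cbox c d" for c d
    by (rule integrable_continuous) (rule continuous_on_subset[OF cont], auto)
  have e: "e \<in> Basis" by (simp add: e_def axis_in_Basis_iff)
  have inner: "x \<bullet> e = x $ i" for x by (simp add: e_def inner_axis)
  have mem: "x \<in> cbox c d \<longleftrightarrow> (c $ i \<le> x $ i \<and> x $ i \<le> d $ i) \<and> (\<forall>j. j \<noteq> i \<longrightarrow> c $ j \<le> x $ j \<and> x $ j \<le> d $ j)"
    for x c d :: "real^3" unfolding mem_box_cart by metis
  have e_nth: "e $ i = 1" "\<And>j. j \<noteq> i \<Longrightarrow> e $ j = 0" by (auto simp: e_def axis_def)
  have shift: "integral (cbox c d) (\<lambda>x. h (x + r *\<^sub>R e)) = integral (cbox (c + r *\<^sub>R e) (d + r *\<^sub>R e)) h" for c d r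
    using integral_shift_cbox[of "c + r *\<^sub>R e" "r *\<^sub>R e" "d + r *\<^sub>R e" h] by simp
  have "integral (cbox 0 (b + t *\<^sub>R e)) h
      = integral (cbox 0 (b + t *\<^sub>R e) \<inter> {x. x \<bullet> e \<le> L}) h + integral (cbox 0 (b + t *\<^sub>R e) \<inter> {x. x \<bullet> e \<ge> L}) h"
    by (rule integral_split[OF int e])
  also have "cbox 0 (b + t *\<^sub>R e) \<inter> {x. x \<bullet> e \<le> L} = cell L"
    using t by (intro set_eqI) (auto simp: inner mem e_nth cell_def b_def)
  also have "cbox 0 (b + t *\<^sub>R e) \<inter> {x. x \<bullet> e \<ge> L} = cbox (0 + L *\<^sub>R e) ((\<chi> j. if j = i then t else L) + L *\<^sub>R e)"
    using t by (intro set_eqI) (auto simp: inner mem e_nth b_def)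
  also have "integral \<dots> h = integral P (\<lambda>x. h (x + L *\<^sub>R e))"
    by (simp only: shift P_def)
  also have "(\<lambda>x. h (x + L *\<^sub>R e)) = h" using per by (auto simp: e_def)
  finally have 1: "integral (cbox 0 (b + t *\<^sub>R e)) h = integral (cell L) h + integral P h" .
  have "integral (cbox 0 (b + t *\<^sub>R e)) h
      = integral (cbox 0 (b + t *\<^sub>R e) \<inter> {x. x \<bullet> e \<le> t}) h + integral (cbox 0 (b + t *\<^sub>R e) \<inter> {x. x \<bullet> e \<ge> t}) h"
    by (rule integral_split[OF int e])
  also have "cbox 0 (b + t *\<^sub>R e) \<inter> {x. x \<bullet> e \<le> t} = P"
    using t by (intro set_eqI) (auto simp: inner mem e_nth P_def b_def)
  also have "cbox 0 (b + t *\<^sub>R e) \<inter> {x. x \<bullet> e \<ge> t} = cbox (0 + t *\<^sub>R e) (b + t *\<^sub>R e)"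
    using t by (intro set_eqI) (auto simp: inner mem e_nth b_def)
  also have "integral \<dots> h = integral (cell L) (\<lambda>x. h (x + t *\<^sub>R e))"
    by (simp only: shift cell_def b_def)
  finally show ?thesis using 1 by (simp add: e_def)
qed

text \<open>The integral of the translate by \<open>t\<close> is constant in \<open>t\<close>, while
  differentiation under the integral sign at \<open>t = 0\<close> produces the integral of
  \<open>h'\<close>. Since translations are controlled for \<open>t\<close> in \<open>{0..L}\<close>
  only, both derivatives are one-sided at 0 and are compared by uniqueness within that
  interval.\<close>

lemma integral_cell_pd_zero:
  fixes h :: "real^3 \<Rightarrow> 'b::banach"
  assumes L: "L > 0" and cont: "continuous_on UNIV h" and per: "\<And>x. h (x + L *\<^sub>R axis i 1) = h x"
    and deriv: "\<And>x. ((\<lambda>t. h (x + t *\<^sub>R axis i 1)) has_vector_derivative h' x) (at 0)"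
    and contd: "continuous_on UNIV h'"
  shows "integral (cell L) h' = 0"
proof -
  have comp: "continuous_on A (\<lambda>y. k (f y))" if "continuous_on UNIV k" "continuous_on A f"
    for k :: "real^3 \<Rightarrow> 'b" and f :: "'c::topological_space \<Rightarrow> real^3" and A
    using continuous_on_compose2[OF that] by auto
  have d: "((\<lambda>t. h (x + t *\<^sub>R axis i 1)) has_vector_derivative h' (x + t *\<^sub>R axis i 1)) (at t within {0..L})" for x t
  proof -
    have 1: "((\<lambda>r::real. r - t) has_vector_derivative 1) (at t within {0..L})"
      by (auto intro!: derivative_eq_intros)
    have 2: "((\<lambda>r. h ((x + t *\<^sub>R axis i 1) + r *\<^sub>R axis i 1)) has_vector_derivative h' (x + t *\<^sub>R axis i 1))
              (at (t - t) within (\<lambda>r. r - t) ` {0..L})"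
      using deriv[of "x + t *\<^sub>R axis i 1"] by (simp add: has_vector_derivative_at_within)
    show ?thesis
      using vector_diff_chain_within[OF 1 2] by (simp add: o_def algebra_simps)
  qed
  have "((\<lambda>t. integral (cell L) (\<lambda>x. h (x + t *\<^sub>R axis i 1))) has_vector_derivative
          integral (cell L) (\<lambda>x. h' (x + 0 *\<^sub>R axis i 1))) (at 0 within {0..L})"
    unfolding cell_def
    by (rule leibniz_rule_vector_derivative[of "{0..L}" _ _ "\<lambda>t x. h (x + t *\<^sub>R axis i 1)" "\<lambda>t x. h' (x + t *\<^sub>R axis i 1)"])
       (use L in \<open>auto intro!: d integrable_continuous comp[OF cont] comp[OF contd] continuous_intros simp: split_beta\<close>)
  then have *: "((\<lambda>t. integral (cell L) (\<lambda>x. h (x + t *\<^sub>R axis i 1))) has_vector_derivative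
          integral (cell L) h') (at 0 within {0..L})" by simp
  have "((\<lambda>t. integral (cell L) h) has_vector_derivative integral (cell L) h') (at 0 within {0..L})"
    by (rule has_vector_derivative_transform[OF _ _ *])
       (use L integral_cell_translate[OF cont per] in auto)
  moreover have "((\<lambda>t. integral (cell L) h) has_vector_derivative 0) (at 0 within {0..L})"
    by simp
  ultimately show ?thesis
    using L by (intro vector_derivative_unique_within[of 0 "{0..L}"])
      (auto simp: trivial_limit_within islimpt_Icc)
qed

lemma has_real_derivative_integral_cell:
  fixes F :: "real^3 \<Rightarrow> real \<Rightarrow> real"
  assumes "\<And>x s. s \<in> {0..T} \<Longrightarrow> ((\<lambda>\<tau>. F x \<tau>) has_vector_derivative F' x s) (at s within {0..T})"
    and "continuous_on (UNIV \<times> {0..T}) (\<lambda>(x, s). F x s)"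
    and "continuous_on (UNIV \<times> {0..T}) (\<lambda>(x, s). F' x s)" and "s \<in> {0..T}"
  shows "((\<lambda>\<tau>. integral (cell L) (\<lambda>x. F x \<tau>)) has_real_derivative integral (cell L) (\<lambda>x. F' x s))
           (at s within {0..T})"
  unfolding has_real_derivative_iff_has_vector_derivative cell_def
proof (rule leibniz_rule_vector_derivative[of "{0..T}" _ _ "\<lambda>s x. F x s" "\<lambda>s x. F' x s"])
  have comp: "continuous_on A (\<lambda>y. H (f y) (g y))"
    if "continuous_on (UNIV \<times> {0..T}) (\<lambda>(x, s). H x s)" "continuous_on A f" "continuous_on A g" "g ` A \<subseteq> {0..T}"
    for H :: "real^3 \<Rightarrow> real \<Rightarrow> real" and f :: "'c::topological_space \<Rightarrow> real^3" and g and A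
    using continuous_on_compose2[OF that(1), of A "\<lambda>y. (f y, g y)"] that by (auto intro!: continuous_intros)
  show "(\<lambda>x. F x s) integrable_on cbox 0 (\<chi> i. L)" if "s \<in> {0..T}" for s
    by (rule integrable_continuous) (rule comp[OF assms(2)], use that in \<open>auto intro!: continuous_intros\<close>)
  show "continuous_on ({0..T} \<times> cbox 0 (\<chi> i. L)) (\<lambda>(s, x). F' x s)"
    unfolding split_beta
    by (rule comp[OF assms(3)]) (auto intro!: continuous_intros)
qed (use assms in auto)

lemma continuous_on_integral_cell:
  fixes F :: "real^3 \<Rightarrow> real \<Rightarrow> 'b::banach"
  assumes "continuous_on (UNIV \<times> {0..T}) (\<lambda>(x, s). F x s)"
  shows "continuous_on {0..T} (\<lambda>s. integral (cell L) (\<lambda>x. F x s))"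
  unfolding cell_def
proof (rule integral_continuous_on_param)
  show "continuous_on ({0..T} \<times> cbox 0 (\<chi> i. L)) (\<lambda>(s, x). F x s)"
    unfolding split_beta
    by (rule continuous_on_compose2[OF assms, of _ "\<lambda>y. (snd y, fst y)", unfolded split_beta fst_conv snd_conv])
       (auto intro!: continuous_on_Pair continuous_on_fst continuous_on_snd continuous_on_id)
qed

subsection \<open>Fourier coefficients on the cell\<close>

definition fchar :: "real \<Rightarrow> int^3 \<Rightarrow> real^3 \<Rightarrow> complex" where
  "fchar L k x = cis (2 * pi * kdot k x / L)"

lemma fchar_0 [simp]: "fchar L 0 x = 1"
  by (simp add: fchar_def kdot_def)

lemma fchar_add: "fchar L (k + l) x = fchar L k x * fchar L l x"
proof -
  have "kdot (k + l) x = kdot k x + kdot l x"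
    by (simp add: kdot_def sum.distrib distrib_right)
  then show ?thesis
    by (simp add: fchar_def cis_mult distrib_left add_divide_distrib)
qed

lemma cnj_fchar: "cnj (fchar L k x) = fchar L (- k) x"
  by (simp add: fchar_def kdot_def cis_cnj sum_negf)

lemma norm_fchar [simp]: "norm (fchar L k x) = 1"
  by (simp add: fchar_def)

lemma continuous_on_fchar [continuous_intros]:
  "continuous_on A f \<Longrightarrow> continuous_on A (\<lambda>y. fchar L k (f y))"
  unfolding fchar_def kdot_def divide_inverse by (intro continuous_intros) auto

lemma fchar_shift: "fchar L k (x + t *\<^sub>R axis i 1) = fchar L k x * cis (2 * pi * (k $ i) * t / L)"
proof -
  have "kdot k (x + t *\<^sub>R axis i 1) = kdot k x + k $ i * t"
  proof -
    have "(\<Sum>j\<in>UNIV. of_int (k $ j) * (x + t *\<^sub>R axis i 1) $ j)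
        = (\<Sum>j\<in>UNIV. of_int (k $ j) * x $ j + (if j = i then k $ i * t else 0))"
      by (rule sum.cong) (auto simp: axis_def distrib_left)
    then show ?thesis by (simp add: kdot_def sum.distrib)
  qed
  then show ?thesis
    by (simp add: fchar_def cis_mult distrib_left add_divide_distrib mult.assoc)
qed

lemma fchar_periodic:
  assumes "L > 0"
  shows "fchar L k (x + L *\<^sub>R axis i 1) = fchar L k x"
proof -
  have "2 * pi * (k $ i) * L / L = 2 * pi * of_int (k $ i)" using assms by simp
  then have "cis (2 * pi * (k $ i) * L / L) = 1" by (simp only: cis_multiple_2pi Ints_of_int)
  then show ?thesis by (simp only: fchar_shift mult_1_right)
qed

lemma has_vector_derivative_fchar:
  "((\<lambda>t. fchar L k (x + t *\<^sub>R axis i 1)) has_vector_derivative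
      \<i> * of_real (2 * pi * (k $ i) / L) * fchar L k x) (at 0)"
proof -
  have "((\<lambda>t. cis (2 * pi * (k $ i) / L * t)) has_derivative
      (\<lambda>h. (2 * pi * (k $ i) / L * h) *\<^sub>R (\<i> * cis (2 * pi * (k $ i) / L * 0)))) (at 0)"
    by (rule has_derivative_cis[OF bounded_linear_imp_has_derivative[OF bounded_linear_mult_right]])
  then have "((\<lambda>t. cis (2 * pi * (k $ i) / L * t)) has_vector_derivative
      \<i> * of_real (2 * pi * (k $ i) / L)) (at 0)"
    by (simp add: has_vector_derivative_def scaleR_conv_of_real mult_ac)
  from has_vector_derivative_mult_right[OF this, of "fchar L k x"]
  show ?thesis by (simp add: fchar_shift mult_ac)
qed

lemma has_integral_cell:
  fixes h :: "real^3 \<Rightarrow> 'b::banach"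
  shows "continuous_on UNIV h \<Longrightarrow> (h has_integral integral (cell L) h) (cell L)"
  by (simp add: integrable_on_cell has_integral_integral[symmetric])

text \<open>For a nonzero frequency choose a direction with \<open>k $ i \<noteq> 0\<close>: up to a
  nonzero factor the character is its own partial derivative there, and such derivatives integrate
  to zero over the cell.\<close>

lemma has_integral_fchar:
  assumes "L > 0"
  shows "(fchar L k has_integral (if k = 0 then of_real (L ^ 3) else 0)) (cell L)"
proof (cases "k = 0")
  case True
  have "((\<lambda>x. 1 :: complex) has_integral (measure lborel (cell L) *\<^sub>R 1)) (cell L)"
    unfolding cell_def by (rule has_integral_const)
  then show ?thesis using True assms
    by (simp add: content_cell scaleR_conv_of_real fchar_def[abs_def] kdot_def)
next
  case False
  then obtain i where i: "k $ i \<noteq> 0" by (auto simp: vec_eq_iff)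
  have "integral (cell L) (\<lambda>x. \<i> * of_real (2 * pi * (k $ i) / L) * fchar L k x) = 0"
    by (rule integral_cell_pd_zero[OF assms _ _ has_vector_derivative_fchar])
       (use assms in \<open>auto intro!: continuous_intros fchar_periodic\<close>)
  then have "integral (cell L) (fchar L k) = 0"
    using i assms by simp
  moreover have "(fchar L k has_integral integral (cell L) (fchar L k)) (cell L)"
    by (rule has_integral_cell) (auto intro!: continuous_intros)
  ultimately show ?thesis using False by simp
qed

lemma fcoef_eq: "fcoef L h k = of_real (1 / L^3) * integral (cell L) (\<lambda>x. of_real (h x) * fchar L (- k) x)"
  by (simp add: fcoef_def fchar_def kdot_def sum_negf)

lemma has_integral_fcoef:
  assumes "L > 0" "continuous_on UNIV h"
  shows "((\<lambda>x. of_real (h x) * fchar L (- k) x) has_integral of_real (L ^ 3) * fcoef L h k) (cell L)"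
proof -
  have "((\<lambda>x. of_real (h x) * fchar L (- k) x) has_integral
       integral (cell L) (\<lambda>x. of_real (h x) * fchar L (- k) x)) (cell L)"
    by (rule has_integral_cell) (auto intro!: continuous_intros assms)
  then show ?thesis using assms(1) by (simp add: fcoef_eq)
qed

lemma has_integral_fcoef_cnj:
  assumes "L > 0" "continuous_on UNIV h"
  shows "((\<lambda>x. of_real (h x) * fchar L k x) has_integral of_real (L ^ 3) * cnj (fcoef L h k)) (cell L)"
  using has_integral_cnj[THEN iffD2, OF has_integral_fcoef[OF assms, of k]] by (simp add: cnj_fchar o_def)

lemma fcoef_minus: 
  assumes "L > 0" "continuous_on UNIV h"
  shows "fcoef L h (- k) = cnj (fcoef L h k)"
  using has_integral_unique[OF has_integral_fcoef[OF assms, of "- k", simplified] has_integral_fcoef_cnj[OF assms, of k]]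
    assms(1) by simp

text \<open>Integration by parts: the partial derivative of the product of \<open>h\<close> with a
  character integrates to zero, and differentiating the character only multiplies it by a
  constant.\<close>

lemma fcoef_pd:
  assumes L: "L > 0" and cont: "continuous_on UNIV h" and per: "\<And>x. h (x + L *\<^sub>R axis i 1) = h x"
    and deriv: "\<And>x. ((\<lambda>t. h (x + t *\<^sub>R axis i 1)) has_vector_derivative h' x) (at 0)"
    and contd: "continuous_on UNIV h'"
  shows "fcoef L h' k = \<i> * of_real (2 * pi * (k $ i) / L) * fcoef L h k"
proof -
  let ?c = "\<i> * of_real (2 * pi * (k $ i) / L)"
  have d: "((\<lambda>t. of_real (h (x + t *\<^sub>R axis i 1)) * fchar L (- k) (x + t *\<^sub>R axis i 1)) has_vector_derivative
        of_real (h' x) * fchar L (- k) x - ?c * (of_real (h x) * fchar L (- k) x)) (at 0)" for x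
    using has_vector_derivative_mult[OF bounded_linear.has_vector_derivative[OF bounded_linear_of_real deriv[of x]]
        has_vector_derivative_fchar[of L "- k" x i]]
    by (simp add: algebra_simps)
  have 0: "integral (cell L) (\<lambda>x. of_real (h' x) * fchar L (- k) x - ?c * (of_real (h x) * fchar L (- k) x)) = 0"
    by (rule integral_cell_pd_zero[OF L _ _ d])
       (use L in \<open>auto intro!: continuous_intros cont contd simp: fchar_periodic per\<close>)
  have "((\<lambda>x. of_real (h' x) * fchar L (- k) x - ?c * (of_real (h x) * fchar L (- k) x)) has_integral
      of_real (L ^ 3) * fcoef L h' k - ?c * (of_real (L ^ 3) * fcoef L h k)) (cell L)"
    by (intro has_integral_diff has_integral_mult_right has_integral_fcoef L cont contd)
  from integral_unique[OF this] 0 L show ?thesis by (simp add: field_simps)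
qed

text \<open>Pythagoras in mean square: orthogonality of characters collapses the double sum, and
  completing the square in each \<open>c k\<close> isolates the distance to the Fourier coefficient.
  Taking \<open>c\<close> to be \<open>fcoef L h\<close> gives Bessel's inequality and the exact
  error of a Fourier sum; arbitrary \<open>c\<close> shows that the Fourier sum is the best
  approximation with frequencies in \<open>F\<close>.\<close>

lemma integral_dist_trig_sum:
  assumes L: "L > 0" and cont: "continuous_on UNIV h" and F: "finite F"
  shows "((\<lambda>x. (norm (of_real (h x) - (\<Sum>k\<in>F. c k * fchar L k x)))\<^sup>2) has_integral
      (integral (cell L) (\<lambda>x. (h x)\<^sup>2) - L ^ 3 * (\<Sum>k\<in>F. (norm (fcoef L h k))\<^sup>2)
        + L ^ 3 * (\<Sum>k\<in>F. (norm (c k - fcoef L h k))\<^sup>2))) (cell L)"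
proof -
  let ?a = "fcoef L h"
  let ?I = "integral (cell L) (\<lambda>x. (h x)\<^sup>2)"
  have pw: "complex_of_real ((norm (of_real (h x) - (\<Sum>k\<in>F. c k * fchar L k x)))\<^sup>2)
     = of_real ((h x)\<^sup>2) - (\<Sum>k\<in>F. c k * (of_real (h x) * fchar L k x))
       - (\<Sum>k\<in>F. cnj (c k) * (of_real (h x) * fchar L (- k) x))
       + (\<Sum>k\<in>F. \<Sum>l\<in>F. c k * cnj (c l) * fchar L (k - l) x)" for x
  proof -
    have *: "(H - S) * (H - S') = H * H - S * H - S' * H + S * S'" for H S S' :: complex
      by (simp add: algebra_simps)
    have "fchar L (k - l) x = fchar L k x * fchar L (- l) x" for k l
      using fchar_add[of L k "- l" x] by simp
    note e = this
    have S: "(\<Sum>k\<in>F. c k * fchar L k x) * of_real (h x) = (\<Sum>k\<in>F. c k * (of_real (h x) * fchar L k x))"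
      "(\<Sum>k\<in>F. cnj (c k) * fchar L (- k) x) * of_real (h x) = (\<Sum>k\<in>F. cnj (c k) * (of_real (h x) * fchar L (- k) x))"
      "(\<Sum>k\<in>F. c k * fchar L k x) * (\<Sum>k\<in>F. cnj (c k) * fchar L (- k) x)
        = (\<Sum>k\<in>F. \<Sum>l\<in>F. c k * cnj (c l) * fchar L (k - l) x)"
      unfolding sum_product e by (simp_all add: sum_distrib_left sum_distrib_right mult_ac)
    show ?thesis
      unfolding complex_norm_square
      by (simp add: cnj_fchar * S) (simp add: power2_eq_square)
  qed
  have "((\<lambda>x. of_real ((h x)\<^sup>2) - (\<Sum>k\<in>F. c k * (of_real (h x) * fchar L k x))
       - (\<Sum>k\<in>F. cnj (c k) * (of_real (h x) * fchar L (- k) x))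
       + (\<Sum>k\<in>F. \<Sum>l\<in>F. c k * cnj (c l) * fchar L (k - l) x)) has_integral
      of_real ?I - (\<Sum>k\<in>F. c k * (of_real (L ^ 3) * cnj (?a k)))
       - (\<Sum>k\<in>F. cnj (c k) * (of_real (L ^ 3) * ?a k))
       + (\<Sum>k\<in>F. \<Sum>l\<in>F. c k * cnj (c l) * (if k - l = 0 then of_real (L ^ 3) else 0))) (cell L)"
    by (intro has_integral_add has_integral_diff has_integral_sum has_integral_mult_right F
          has_integral_fcoef has_integral_fcoef_cnj has_integral_fchar L cont has_integral_of_real has_integral_cell)
       (auto intro!: continuous_intros cont)
  also have "of_real ?I - (\<Sum>k\<in>F. c k * (of_real (L ^ 3) * cnj (?a k)))
       - (\<Sum>k\<in>F. cnj (c k) * (of_real (L ^ 3) * ?a k))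
       + (\<Sum>k\<in>F. \<Sum>l\<in>F. c k * cnj (c l) * (if k - l = 0 then of_real (L ^ 3) else 0))
     = of_real ?I + of_real (L ^ 3) * (\<Sum>k\<in>F. c k * cnj (c k) - c k * cnj (?a k) - cnj (c k) * ?a k)"
  proof -
    have "(\<Sum>l\<in>F. c k * cnj (c l) * (if k - l = 0 then of_real (L ^ 3) else 0)) = of_real (L ^ 3) * (c k * cnj (c k))"
      if "k \<in> F" for k
    proof -
      have "(\<Sum>l\<in>F. c k * cnj (c l) * (if k - l = 0 then of_real (L ^ 3) else 0))
          = (\<Sum>l\<in>F. if l = k then of_real (L ^ 3) * (c k * cnj (c k)) else 0)"
        by (rule sum.cong) auto
      then show ?thesis using F that by simp
    qed
    then show ?thesis
      by (simp add: sum_subtractf sum_distrib_left right_diff_distrib mult.left_commute)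
  qed
  also have "\<dots> = complex_of_real (?I - L ^ 3 * (\<Sum>k\<in>F. (norm (?a k))\<^sup>2) + L ^ 3 * (\<Sum>k\<in>F. (norm (c k - ?a k))\<^sup>2))"
  proof -
    have "(c k - ?a k) * cnj (c k - ?a k) = (c k * cnj (c k) - c k * cnj (?a k) - cnj (c k) * ?a k) + ?a k * cnj (?a k)" for k
      by (simp add: algebra_simps)
    then show ?thesis
      by (simp only: of_real_add of_real_diff of_real_mult of_real_sum complex_norm_square sum.distrib)
         (simp add: distrib_left)
  qed
  finally have "((\<lambda>x. complex_of_real ((norm (of_real (h x) - (\<Sum>k\<in>F. c k * fchar L k x)))\<^sup>2)) has_integral
     complex_of_real (?I - L ^ 3 * (\<Sum>k\<in>F. (norm (?a k))\<^sup>2) + L ^ 3 * (\<Sum>k\<in>F. (norm (c k - ?a k))\<^sup>2))) (cell L)"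
    by (simp only: pw)
  from has_integral_Re[OF this] show ?thesis by simp
qed

lemma bessel:
  assumes "L > 0" "continuous_on UNIV h" "finite F"
  shows "L ^ 3 * (\<Sum>k\<in>F. (norm (fcoef L h k))\<^sup>2) \<le> integral (cell L) (\<lambda>x. (h x)\<^sup>2)"
  using has_integral_nonneg[OF integral_dist_trig_sum[OF assms, of "fcoef L h"]] by simp

subsection \<open>Density of trigonometric polynomials\<close>

text \<open>Generated by characters and sums so that closure under products follows by induction.
  The form with one coefficient per frequency, on which the mean-square identity operates, is
  recovered by \<open>trig_poly_sum_form\<close>.\<close>

inductive trig_poly :: "real \<Rightarrow> (real^3 \<Rightarrow> complex) \<Rightarrow> bool" for L where
  char: "trig_poly L (\<lambda>x. c * fchar L k x)"
| add: "trig_poly L f \<Longrightarrow> trig_poly L g \<Longrightarrow> trig_poly L (\<lambda>x. f x + g x)"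

lemma trig_poly_const: "trig_poly L (\<lambda>x. c)"
  using trig_poly.char[of L c 0] by simp

lemma trig_poly_char_mult: "trig_poly L g \<Longrightarrow> trig_poly L (\<lambda>x. c * fchar L k x * g x)"
proof (induction rule: trig_poly.induct)
  case (char d l)
  have "(\<lambda>x. c * fchar L k x * (d * fchar L l x)) = (\<lambda>x. (c * d) * fchar L (k + l) x)"
    by (auto simp: fchar_add)
  then show ?case using trig_poly.char by metis
next
  case (add f g)
  then show ?case using trig_poly.add[OF add.IH] by (simp add: distrib_left)
qed

lemma trig_poly_mult: "trig_poly L f \<Longrightarrow> trig_poly L g \<Longrightarrow> trig_poly L (\<lambda>x. f x * g x)"
proof (induction rule: trig_poly.induct)
  case (char c k)
  then show ?case by (rule trig_poly_char_mult)
next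
  case (add f f')
  then show ?case using trig_poly.add[of L "\<lambda>x. f x * g x" "\<lambda>x. f' x * g x"] by (simp add: distrib_right)
qed

lemma trig_poly_sum:
  assumes "finite A" "\<And>a. a \<in> A \<Longrightarrow> trig_poly L (f a)"
  shows "trig_poly L (\<lambda>x. \<Sum>a\<in>A. f a x)"
  using assms
proof (induction rule: finite_induct)
  case empty
  show ?case using trig_poly_const[of L 0] by simp
next
  case (insert a A)
  then show ?case using trig_poly.add[of L "f a" "\<lambda>x. \<Sum>a\<in>A. f a x"] by simp
qed

lemma trig_poly_sum_form:
  assumes "trig_poly L f"
  shows "\<exists>F c. finite F \<and> f = (\<lambda>x. \<Sum>k\<in>F. c k * fchar L k x)"
  using assms
proof (induction rule: trig_poly.induct)
  case (char c k)
  show ?case by (rule exI[of _ "{k}"], rule exI[of _ "\<lambda>_. c"]) simp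
next
  case (add f g)
  then obtain F c G d where F: "finite F" "f = (\<lambda>x. \<Sum>k\<in>F. c k * fchar L k x)"
    and G: "finite G" "g = (\<lambda>x. \<Sum>k\<in>G. d k * fchar L k x)" by blast
  have 1: "f x = (\<Sum>k\<in>F \<union> G. (if k \<in> F then c k else 0) * fchar L k x)" for x
    unfolding F(2) by (rule sum.mono_neutral_cong_left) (use F(1) G(1) in auto)
  have 2: "g x = (\<Sum>k\<in>F \<union> G. (if k \<in> G then d k else 0) * fchar L k x)" for x
    unfolding G(2) by (rule sum.mono_neutral_cong_left) (use F(1) G(1) in auto)
  show ?case
    by (rule exI[of _ "F \<union> G"], rule exI[of _ "\<lambda>k. (if k \<in> F then c k else 0) + (if k \<in> G then d k else 0)"])
       (use F(1) G(1) in \<open>simp add: 1 2 sum.distrib distrib_right\<close>)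
qed

text \<open>The embedding of the torus into a Euclidean space. It turns periodic functions into
  functions on a compact set, where polynomial approximation applies.\<close>

definition torus_map :: "real \<Rightarrow> real^3 \<Rightarrow> complex^3" where
  "torus_map L x = (\<chi> i. fchar L (axis i 1) x)"

lemma trig_poly_polynomial:
  assumes "real_polynomial_function P"
  shows "trig_poly L (\<lambda>x. of_real (P (torus_map L x)))"
  using assms
proof (induction rule: real_polynomial_function.induct)
  case (linear F)
  interpret F: bounded_linear F by fact
  \<comment> \<open>A real-linear functional sees the real and imaginary parts of each coordinate
    \<open>w\<close>. These are \<open>(w + cnj w) / 2\<close> and
    \<open>(w - cnj w) / (2 * \<i>)\<close>, and the conjugate of a character is the character of
    the opposite frequency.\<close>
  have eq: "complex_of_real (F (torus_map L x)) =
      (\<Sum>i\<in>UNIV. (F (axis i 1) / 2 + F (axis i \<i>) / (2 * \<i>)) * fchar L (axis i 1) x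
           + (F (axis i 1) / 2 - F (axis i \<i>) / (2 * \<i>)) * fchar L (- axis i 1) x)" for x
  proof -
    have "torus_map L x = (\<Sum>i\<in>UNIV. Re (fchar L (axis i 1) x) *\<^sub>R axis i 1 + Im (fchar L (axis i 1) x) *\<^sub>R axis i \<i>)"
      by (simp add: vec_eq_iff torus_map_def axis_def complex_eq_iff if_distrib cong: if_cong)
    then have "F (torus_map L x) = (\<Sum>i\<in>UNIV. Re (fchar L (axis i 1) x) * F (axis i 1) + Im (fchar L (axis i 1) x) * F (axis i \<i>))"
      by (simp add: F.sum F.add F.scaleR)
    moreover have "complex_of_real (Re w * a + Im w * b) = (a / 2 + b / (2 * \<i>)) * w + (a / 2 - b / (2 * \<i>)) * cnj w" for w a b
      by (simp add: complex_eq_iff)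
    ultimately show ?thesis by (simp add: cnj_fchar)
  qed
  show ?case unfolding eq by (intro trig_poly_sum trig_poly.intros) auto
next
  case (const c)
  show ?case by (rule trig_poly_const)
next
  case (add f g)
  then show ?case using trig_poly.add[OF add.IH] by simp
next
  case (mult f g)
  then show ?case using trig_poly_mult[OF mult.IH] by simp
qed

lemma kdot_axis: "kdot (axis i 1) x = x $ i"
proof -
  have "kdot (axis i 1) x = (\<Sum>j\<in>UNIV. if j = i then x $ i else 0)"
    unfolding kdot_def by (rule sum.cong) (auto simp: axis_def)
  then show ?thesis by simp
qed

lemma periodic_int_shift:
  fixes h :: "real^3 \<Rightarrow> 'b"
  assumes "\<And>x. h (x + L *\<^sub>R axis i 1) = h x"
  shows "h (x + (of_int n * L) *\<^sub>R axis i 1) = h x"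
proof -
  have nat: "h (x + (of_nat m * L) *\<^sub>R axis i 1) = h x" for x m
  proof (induction m)
    case (Suc m)
    have "x + (of_nat (Suc m) * L) *\<^sub>R axis i 1 = x + (of_nat m * L) *\<^sub>R axis i 1 + L *\<^sub>R axis i 1"
      by (simp add: algebra_simps)
    then show ?case using Suc assms by metis
  qed simp
  show ?thesis
  proof (cases "n \<ge> 0")
    case True
    then show ?thesis using nat[of x "nat n"] by simp
  next
    case False
    then have "x = x + (of_int n * L) *\<^sub>R axis i 1 + (of_nat (nat (- n)) * L) *\<^sub>R axis i 1"
      by (simp add: algebra_simps)
    then show ?thesis using nat by metis
  qed
qed

text \<open>The fibres of \<open>torus_map\<close> are translates of the lattice of periods:
  equality of sine and cosine determines each coordinate up to an integer multiple of
  \<open>L\<close>, and three successive shifts remove these multiples.\<close>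

lemma torus_map_eq_imp:
  fixes h :: "real^3 \<Rightarrow> 'b"
  assumes L: "L > 0" and per: "\<And>x i. h (x + L *\<^sub>R axis i 1) = h x" and eq: "torus_map L x = torus_map L y"
  shows "h x = h y"
proof -
  have "\<exists>n::int. x $ i = y $ i + of_int n * L" for i
  proof -
    have "cis (2 * pi * x $ i / L) = cis (2 * pi * y $ i / L)"
      using eq by (simp add: torus_map_def vec_eq_iff fchar_def kdot_axis)
    then have "sin (2 * pi * x $ i / L) = sin (2 * pi * y $ i / L) \<and> cos (2 * pi * x $ i / L) = cos (2 * pi * y $ i / L)"
      by (simp add: complex_eq_iff)
    then obtain n :: int where "2 * pi * x $ i / L = 2 * pi * y $ i / L + 2 * pi * n"
      unfolding sin_cos_eq_iff by blast
    then have "2 * pi * x $ i = 2 * pi * (y $ i + of_int n * L)" using L by (simp add: field_simps)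
    then have "x $ i = y $ i + of_int n * L" unfolding mult_cancel_left by simp
    then show ?thesis by blast
  qed
  then obtain n :: "3 \<Rightarrow> int" where n: "\<And>i. x $ i = y $ i + of_int (n i) * L" by metis
  have "x = y + (of_int (n 1) * L) *\<^sub>R axis 1 1 + (of_int (n 2) * L) *\<^sub>R axis 2 1 + (of_int (n 3) * L) *\<^sub>R axis 3 1"
    by (simp add: vec_eq_iff forall_3 n axis_def)
  then show ?thesis using periodic_int_shift[of h L, OF per] by simp
qed

lemma trig_poly_dense:
  fixes h :: "real^3 \<Rightarrow> real"
  assumes L: "L > 0" and cont: "continuous_on UNIV h" and per: "\<And>x i. h (x + L *\<^sub>R axis i 1) = h x" and "\<epsilon> > 0"
  obtains g where "trig_poly L g" "\<And>x. x \<in> cell L \<Longrightarrow> norm (of_real (h x) - g x) < \<epsilon>"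
proof -
  \<comment> \<open>\<open>H\<close> is \<open>h\<close> carried over to the torus. Opposite faces
    of the closed cell have the same image, so a preimage is chosen; periodicity makes the value
    independent of the choice.\<close>
  define H where "H z = h (SOME x. x \<in> cell L \<and> torus_map L x = z)" for z
  have H: "H (torus_map L x) = h x" if "x \<in> cell L" for x
  proof -
    have "torus_map L (SOME y. y \<in> cell L \<and> torus_map L y = torus_map L x) = torus_map L x"
      using someI[of "\<lambda>y. y \<in> cell L \<and> torus_map L y = torus_map L x" x] that by blast
    then show ?thesis unfolding H_def by (rule torus_map_eq_imp[OF L per])
  qed
  have ct: "continuous_on A (torus_map L)" for A
    unfolding torus_map_def by (intro continuous_intros)
  have cpt: "compact (cell L)" by (simp add: cell_def)
  let ?S = "torus_map L ` cell L"
  have S: "compact ?S" by (rule compact_continuous_image[OF ct cpt])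
  \<comment> \<open>\<open>torus_map\<close> has no inverse on the cell to compose with. Instead the
    preimage of a closed set under \<open>H\<close> is the image of a compact subset of the cell,
    hence closed.\<close>
  have "continuous_on ?S H"
    unfolding continuous_on_closed_vimage[OF compact_imp_closed[OF S]]
  proof (intro allI impI)
    fix B :: "real set" assume "closed B"
    have "H -` B \<inter> ?S = torus_map L ` (cell L \<inter> h -` B)" using H by auto
    moreover have "compact (cell L \<inter> h -` B)"
      using continuous_closed_vimage[OF \<open>closed B\<close>, of h] cont cpt
      by (auto simp: continuous_on_eq_continuous_at intro: compact_Int_closed)
    ultimately show "closed (H -` B \<inter> ?S)"
      using compact_continuous_image[OF ct] compact_imp_closed by metis
  qed
  from Stone_Weierstrass_real_polynomial_function[OF S this \<open>\<epsilon> > 0\<close>]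
  obtain P where P: "real_polynomial_function P" "\<And>z. z \<in> ?S \<Longrightarrow> \<bar>H z - P z\<bar> < \<epsilon>" by metis
  show thesis
  proof (rule that[OF trig_poly_polynomial[OF P(1)]])
    fix x assume "x \<in> cell L"
    then have "\<bar>h x - P (torus_map L x)\<bar> < \<epsilon>" using P(2) H by force
    then show "norm (complex_of_real (h x) - of_real (P (torus_map L x))) < \<epsilon>"
      by (metis norm_of_real of_real_diff)
  qed
qed

lemma fourier_sum_L2_dense:
  fixes h :: "real^3 \<Rightarrow> real"
  assumes L: "L > 0" and cont: "continuous_on UNIV h" and per: "\<And>x i. h (x + L *\<^sub>R axis i 1) = h x" and "\<epsilon> > 0"
  obtains F where "finite F" "integral (cell L) (\<lambda>x. (h x)\<^sup>2) - L ^ 3 * (\<Sum>k\<in>F. (norm (fcoef L h k))\<^sup>2) \<le> \<epsilon>"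
proof -
  \<comment> \<open>A uniform error \<eta> costs \<eta> squared times the volume of the cell in mean
    square. The coefficients of the uniform approximant are not Fourier coefficients, but by
    Pythagoras replacing them only decreases the error.\<close>
  define \<eta> where "\<eta> = sqrt (\<epsilon> / L ^ 3)"
  have \<eta>: "\<eta> > 0" "\<eta>\<^sup>2 * L ^ 3 = \<epsilon>" using L \<open>\<epsilon> > 0\<close> by (auto simp: \<eta>_def)
  obtain g where g: "trig_poly L g" "\<And>x. x \<in> cell L \<Longrightarrow> norm (of_real (h x) - g x) < \<eta>"
    using trig_poly_dense[OF L cont per \<eta>(1)] by metis
  obtain F c where F: "finite F" "g = (\<lambda>x. \<Sum>k\<in>F. c k * fchar L k x)"
    using trig_poly_sum_form[OF g(1)] by blast
  have "integral (cell L) (\<lambda>x. (h x)\<^sup>2) - L ^ 3 * (\<Sum>k\<in>F. (norm (fcoef L h k))\<^sup>2)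
      + L ^ 3 * (\<Sum>k\<in>F. (norm (c k - fcoef L h k))\<^sup>2) \<le> measure lborel (cell L) *\<^sub>R \<eta>\<^sup>2"
  proof (rule has_integral_le[OF integral_dist_trig_sum[OF L cont F(1)]])
    show "((\<lambda>x. \<eta>\<^sup>2) has_integral measure lborel (cell L) *\<^sub>R \<eta>\<^sup>2) (cell L)"
      unfolding cell_def by (rule has_integral_const)
    show "(norm (of_real (h x) - (\<Sum>k\<in>F. c k * fchar L k x)))\<^sup>2 \<le> \<eta>\<^sup>2" if "x \<in> cell L" for x
      using g(2)[OF that] by (intro power_mono) (auto simp: F(2))
  qed
  moreover have "L ^ 3 * (\<Sum>k\<in>F. (norm (c k - fcoef L h k))\<^sup>2) \<ge> 0"
    using L by (simp add: sum_nonneg)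
  ultimately show thesis using that[OF F(1)] \<eta>(2) L by (simp add: content_cell mult.commute)
qed

text \<open>A weak form of Parseval's identity that avoids infinite sums.\<close>

lemma integral_mult_le_fcoef:
  fixes f u :: "real^3 \<Rightarrow> real"
  assumes L: "L > 0" and cf: "continuous_on UNIV f" and per: "\<And>x i. f (x + L *\<^sub>R axis i 1) = f x"
    and cu: "continuous_on UNIV u" and "\<epsilon> > 0"
  obtains F where "finite F"
    "integral (cell L) (\<lambda>x. f x * u x) \<le> L ^ 3 * (\<Sum>k\<in>F. norm (fcoef L f k) * norm (fcoef L u k)) + \<epsilon>"
proof -
  define U where "U = integral (cell L) (\<lambda>x. (u x)\<^sup>2)"
  have hU: "((\<lambda>x. (u x)\<^sup>2) has_integral U) (cell L)"
    unfolding U_def by (rule has_integral_cell) (intro continuous_intros cu)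
  have U: "U \<ge> 0" by (rule has_integral_nonneg[OF hU]) simp
  \<comment> \<open>The weight for Young's inequality on the remainder times \<open>u\<close>. It
    makes \<open>\<eta> * U\<close> at most \<epsilon>, with the summand 1 guarding against
    \<open>U = 0\<close>; choosing \<open>F\<close> with error at most
    \<open>\<epsilon> * \<eta>\<close> then makes \<open>R / \<eta>\<close> at most \<epsilon>, and
    the bound is the mean of the two.\<close>
  define \<eta> where "\<eta> = \<epsilon> / (U + 1)"
  have \<eta>: "\<eta> > 0" using U \<open>\<epsilon> > 0\<close> by (simp add: \<eta>_def)
  obtain F where F: "finite F"
      "integral (cell L) (\<lambda>x. (f x)\<^sup>2) - L ^ 3 * (\<Sum>k\<in>F. (norm (fcoef L f k))\<^sup>2) \<le> \<epsilon> * \<eta>"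
    using fourier_sum_L2_dense[OF L cf per, of "\<epsilon> * \<eta>"] \<eta> \<open>\<epsilon> > 0\<close> by auto
  define R where "R = integral (cell L) (\<lambda>x. (f x)\<^sup>2) - L ^ 3 * (\<Sum>k\<in>F. (norm (fcoef L f k))\<^sup>2)"
  define S where "S x = (\<Sum>k\<in>F. fcoef L f k * fchar L k x)" for x
  have hR: "((\<lambda>x. (norm (of_real (f x) - S x))\<^sup>2) has_integral R) (cell L)"
    using integral_dist_trig_sum[OF L cf F(1), of "fcoef L f"] by (simp add: S_def R_def)
  let ?P = "\<Sum>k\<in>F. fcoef L f k * (of_real (L ^ 3) * cnj (fcoef L u k))"
  have "((\<lambda>x. \<Sum>k\<in>F. fcoef L f k * (of_real (u x) * fchar L k x)) has_integral ?P) (cell L)"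
    by (intro has_integral_sum has_integral_mult_right has_integral_fcoef_cnj L cu F(1))
  moreover have "(\<lambda>x. \<Sum>k\<in>F. fcoef L f k * (of_real (u x) * fchar L k x)) = (\<lambda>x. S x * of_real (u x))"
    by (simp add: S_def sum_distrib_left mult_ac)
  ultimately have hP: "((\<lambda>x. S x * of_real (u x)) has_integral ?P) (cell L)" by simp
  have hfu: "((\<lambda>x. f x * u x) has_integral integral (cell L) (\<lambda>x. f x * u x)) (cell L)"
    by (rule has_integral_cell) (intro continuous_intros cf cu)
  have hr: "((\<lambda>x. (of_real (f x) - S x) * of_real (u x)) has_integral
      of_real (integral (cell L) (\<lambda>x. f x * u x)) - ?P) (cell L)"
    using has_integral_diff[OF has_integral_of_real[OF hfu] hP] by (simp add: left_diff_distrib)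
  have hb: "((\<lambda>x. (\<eta> * (u x)\<^sup>2 + (norm (of_real (f x) - S x))\<^sup>2 / \<eta>) / 2) has_integral (\<eta> * U + R / \<eta>) / 2) (cell L)"
    by (intro has_integral_divide has_integral_add has_integral_mult_right hU hR)
  have young: "norm (of_real (f x) - S x) * \<bar>u x\<bar> \<le> (\<eta> * (u x)\<^sup>2 + (norm (of_real (f x) - S x))\<^sup>2 / \<eta>) / 2" for x
  proof -
    have "0 \<le> (\<eta> * \<bar>u x\<bar> - norm (of_real (f x) - S x))\<^sup>2 / \<eta>" using \<eta> by simp
    also have "\<dots> = \<eta> * (u x)\<^sup>2 - 2 * (norm (of_real (f x) - S x) * \<bar>u x\<bar>) + (norm (of_real (f x) - S x))\<^sup>2 / \<eta>"
      using \<eta> by (simp add: power2_diff field_simps power2_eq_square)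
    finally show ?thesis by simp
  qed
  have "\<eta> * U \<le> \<epsilon>" using U \<open>\<epsilon> > 0\<close> by (simp add: \<eta>_def field_simps)
  moreover have "R / \<eta> \<le> \<epsilon>" using F(2) \<eta> by (simp add: R_def[symmetric] field_simps)
  ultimately have le_eps: "(\<eta> * U + R / \<eta>) / 2 \<le> \<epsilon>" by argo
  define I where "I = integral (cell L) (\<lambda>x. f x * u x)"
  have "norm (of_real I - ?P) \<le> (\<eta> * U + R / \<eta>) / 2"
    using integral_norm_bound_integral[of "\<lambda>x. (of_real (f x) - S x) * of_real (u x)" "cell L"
        "\<lambda>x. (\<eta> * (u x)\<^sup>2 + (norm (of_real (f x) - S x))\<^sup>2 / \<eta>) / 2"] hr hb young
    by (simp add: has_integral_integrable_integral norm_mult I_def)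
  then have 1: "norm (of_real I - ?P) \<le> \<epsilon>" using le_eps by (rule order_trans)
  have 2: "I - norm ?P \<le> norm (complex_of_real I - ?P)"
    using norm_triangle_ineq2[of "complex_of_real I" ?P] by simp
  have 3: "norm ?P \<le> L ^ 3 * (\<Sum>k\<in>F. norm (fcoef L f k) * norm (fcoef L u k))"
    using norm_sum[of "\<lambda>k. fcoef L f k * (of_real (L ^ 3) * cnj (fcoef L u k))" F] L
    by (simp add: norm_mult norm_power sum_distrib_left mult_ac)
  show thesis
    using that[OF F(1)] add_mono[OF order_trans[OF 2 1] 3] by (simp add: I_def algebra_simps)
qed

subsection \<open>Decay of Fourier coefficients\<close>

text \<open>A majorant of product form, so that its sum factorises over the coordinates. Each factor
  is the reciprocal of the symbol of the operator \<open>one_minus_pd2\<close> in that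
  direction.\<close>

definition cweight :: "int^3 \<Rightarrow> real" where
  "cweight k = (\<Prod>i\<in>UNIV. 1 / (1 + (of_int (k $ i))\<^sup>2))"

text \<open>Telescoping: over \<open>-M..M\<close> the sum is at most
  \<open>5 - 4 / (M + 1)\<close>, with equality at \<open>M = 0\<close>, and the two terms added at
  each step are dominated by the increment \<open>4 / ((M + 1) * (M + 2))\<close>.\<close>

lemma sum_inverse_one_plus_square_le:
  assumes "finite N"
  shows "(\<Sum>n\<in>N. 1 / (1 + (of_int n :: real)\<^sup>2)) \<le> 5"
proof -
  have b: "(\<Sum>n\<in>{- int M..int M}. 1 / (1 + (of_int n :: real)\<^sup>2)) \<le> 5 - 4 / (real M + 1)" for M
  proof (induction M)
    case (Suc M)
    have "{- int (Suc M)..int (Suc M)} = insert (- int (Suc M)) (insert (int (Suc M)) {- int M..int M})"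
      by auto
    then have "(\<Sum>n\<in>{- int (Suc M)..int (Suc M)}. 1 / (1 + (of_int n :: real)\<^sup>2))
        = 2 * (1 / (1 + (real M + 1)\<^sup>2)) + (\<Sum>n\<in>{- int M..int M}. 1 / (1 + (of_int n :: real)\<^sup>2))"
      by (simp add: add.commute power2_eq_square algebra_simps)
    also have "\<dots> \<le> (4 / (real M + 1) - 4 / (real M + 2)) + (5 - 4 / (real M + 1))"
    proof (rule add_mono[OF _ Suc])
      have "4 / (real M + 1) - 4 / (real M + 2) = 4 / ((real M + 1) * (real M + 2))"
        by (simp add: field_simps)
      moreover have "2 * (1 / (1 + (real M + 1)\<^sup>2)) = 4 / (2 * (1 + (real M + 1)\<^sup>2))"
      proof -
        have "2 * (1 / q) = 4 / (2 * q)" for q :: real by simp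
        then show ?thesis .
      qed
      moreover have "(real M + 1) * (real M + 2) \<le> 2 * (1 + (real M + 1)\<^sup>2)"
        by (simp add: power2_eq_square algebra_simps)
      then have "4 / (2 * (1 + (real M + 1)\<^sup>2)) \<le> 4 / ((real M + 1) * (real M + 2))"
        by (intro frac_le) auto
      ultimately show "2 * (1 / (1 + (real M + 1)\<^sup>2)) \<le> 4 / (real M + 1) - 4 / (real M + 2)"
        by (simp only:)
    qed
    finally show ?case by (simp add: add.commute)
  qed simp
  have "N \<subseteq> {- int (nat (Max (insert 0 (abs ` N))))..int (nat (Max (insert 0 (abs ` N))))}" (is "_ \<subseteq> ?B")
  proof
    fix n assume "n \<in> N"
    then have "\<bar>n\<bar> \<le> Max (insert 0 (abs ` N))" using assms by (intro Max_ge) auto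
    then show "n \<in> ?B" by auto
  qed
  then have "(\<Sum>n\<in>N. 1 / (1 + (of_int n :: real)\<^sup>2)) \<le> (\<Sum>n\<in>?B. 1 / (1 + (of_int n :: real)\<^sup>2))"
    by (intro sum_mono2) auto
  also have "\<dots> \<le> 5 - 4 / (real (nat (Max (insert 0 (abs ` N)))) + 1)" by (rule b)
  also have "\<dots> \<le> 5" by simp
  finally show ?thesis .
qed

lemma cweight_nonneg: "cweight k \<ge> 0"
  by (simp add: cweight_def prod_nonneg)

text \<open>A finite set of frequencies lies in a cube with side \<open>N\<close>, the set of all
  coordinates that occur. Over the cube the sum of products is a product of three one-dimensional
  sums, each at most 5.\<close>

lemma cweight_summable: "cweight summable_on A"
proof (rule nonneg_bdd_above_summable_on)
  show "bdd_above (sum cweight ` {F. F \<subseteq> A \<and> finite F})"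
  proof (rule bdd_aboveI2)
    fix F :: "(int^3) set" assume "F \<in> {F. F \<subseteq> A \<and> finite F}"
    then have F: "finite F" by simp
    define N where "N = (\<Union>i. (\<lambda>k. k $ i) ` F)"
    have N: "finite N" using F by (simp add: N_def)
    have inj: "inj_on (\<lambda>k. vec_nth k) F" by (auto intro!: inj_onI simp: vec_eq_iff)
    have "sum cweight F = (\<Sum>g\<in>vec_nth ` F. \<Prod>i\<in>UNIV. 1 / (1 + (of_int (g i))\<^sup>2))"
      using inj by (simp add: sum.reindex cweight_def)
    also have "\<dots> \<le> (\<Sum>g\<in>PiE (UNIV :: 3 set) (\<lambda>_. N). \<Prod>i\<in>UNIV. 1 / (1 + (of_int (g i))\<^sup>2))"
      by (rule sum_mono2) (use N in \<open>auto intro!: finite_PiE prod_nonneg simp: N_def\<close>)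
    also have "\<dots> = (\<Prod>i\<in>(UNIV :: 3 set). \<Sum>n\<in>N. 1 / (1 + (of_int n :: real)\<^sup>2))"
      by (rule prod_sum_PiE[symmetric]) (use N in auto)
    also have "\<dots> \<le> (\<Prod>i\<in>(UNIV :: 3 set). 5)"
      by (rule prod_mono) (use sum_inverse_one_plus_square_le[OF N] in \<open>auto intro!: sum_nonneg\<close>)
    finally show "sum cweight F \<le> 5 ^ 3" by simp
  qed
qed (rule cweight_nonneg)

lemma norm_fcoef_le:
  assumes L: "L > 0" and cont: "continuous_on UNIV h" and C: "\<And>x. x \<in> cell L \<Longrightarrow> \<bar>h x\<bar> \<le> C"
  shows "norm (fcoef L h k) \<le> C"
proof -
  have "norm (of_real (L ^ 3) * fcoef L h k) \<le> C * measure lborel (cell L)"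
    using has_integral_fcoef[OF L cont, of k] unfolding cell_def
  proof (rule has_integral_bound[rotated])
    show "norm (of_real (h x) * fchar L (- k) x) \<le> C" if "x \<in> cbox 0 (\<chi> i. L)" for x
      using C[of x] that by (simp add: cell_def norm_mult)
    have "\<bar>h 0\<bar> \<le> C" using C[of 0] L by (simp add: cell_mem)
    then show "0 \<le> C" by simp
  qed
  then show ?thesis using L by (simp add: norm_mult norm_power content_cell mult.commute)
qed

text \<open>The scaling makes this the Fourier multiplier with symbol one plus the square of
  \<open>k $ i\<close>. The added identity keeps the symbol at least 1 when that coordinate
  vanishes, so the operators in all three directions can be applied in turn and their symbols
  divided out.\<close>

definition one_minus_pd2 :: "real \<Rightarrow> 3 \<Rightarrow> (real^3 \<Rightarrow> real \<Rightarrow> real) \<Rightarrow> real^3 \<Rightarrow> real \<Rightarrow> real" where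
  "one_minus_pd2 L i G x s = G x s - (L / (2 * pi))\<^sup>2 * pd i (\<lambda>y. pd i (\<lambda>y. G y s) y) x"

lemma smooth_st_one_minus_pd2:
  assumes "smooth_st T G" "T > 0"
  shows "smooth_st T (one_minus_pd2 L i G)"
proof -
  have "smooth_st T (\<lambda>x s. G x s + (- (L / (2 * pi))\<^sup>2) *\<^sub>R pd i (\<lambda>y. pd i (\<lambda>y. G y s) y) x)"
    by (rule smooth_st_add[OF assms(1) smooth_st_bounded_linear[OF bounded_linear_scaleR_right
          smooth_st_pd[OF smooth_st_pd[OF assms] assms(2)]]])
  then show ?thesis by (simp add: one_minus_pd2_def[abs_def])
qed

lemma periodic_st_one_minus_pd2:
  assumes "periodic_st L G"
  shows "periodic_st L (one_minus_pd2 L i G)"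
  using assms periodic_st_pd[OF assms, of i] periodic_st_pd[OF periodic_st_pd[OF assms, of i], of i]
  by (simp add: periodic_st_def one_minus_pd2_def)

lemma fcoef_pd_st:
  assumes "smooth_st T G" "periodic_st L G" "T > 0" "L > 0" "s \<in> {0..T}"
  shows "fcoef L (\<lambda>x. pd i (\<lambda>y. G y s) x) k = \<i> * of_real (2 * pi * (k $ i) / L) * fcoef L (\<lambda>x. G x s) k"
  by (rule fcoef_pd[OF assms(4) smooth_st_continuous_slice[OF assms(1,5)] _
        smooth_st_has_pd[OF assms(1,3,5)] smooth_st_continuous_slice[OF smooth_st_pd[OF assms(1,3)] assms(5)]])
     (use assms(2) in \<open>simp add: periodic_st_def\<close>)

lemma fcoef_diff_mult:
  assumes "L > 0" "continuous_on UNIV g" "continuous_on UNIV h"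
  shows "fcoef L (\<lambda>x. g x - c * h x) k = fcoef L g k - of_real c * fcoef L h k"
proof -
  have "((\<lambda>x. of_real (g x) * fchar L (- k) x - of_real c * (of_real (h x) * fchar L (- k) x)) has_integral
      of_real (L ^ 3) * fcoef L g k - of_real c * (of_real (L ^ 3) * fcoef L h k)) (cell L)"
    by (intro has_integral_diff has_integral_mult_right has_integral_fcoef assms)
  moreover have "(\<lambda>x. of_real (g x) * fchar L (- k) x - of_real c * (of_real (h x) * fchar L (- k) x))
     = (\<lambda>x. of_real (g x - c * h x) * fchar L (- k) x)" by (simp add: algebra_simps)
  ultimately have "of_real (L ^ 3) * fcoef L (\<lambda>x. g x - c * h x) k
      = of_real (L ^ 3) * fcoef L g k - of_real c * (of_real (L ^ 3) * fcoef L h k)"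
    using has_integral_unique[OF has_integral_fcoef[OF assms(1), of "\<lambda>x. g x - c * h x" k]]
    by (simp add: continuous_intros assms)
  then have "of_real (L ^ 3) * fcoef L (\<lambda>x. g x - c * h x) k = of_real (L ^ 3) * (fcoef L g k - of_real c * fcoef L h k)"
    by (simp add: algebra_simps)
  then show ?thesis using assms(1) by simp
qed

lemma fcoef_one_minus_pd2:
  assumes "smooth_st T G" "periodic_st L G" "T > 0" "L > 0" "s \<in> {0..T}"
  shows "fcoef L (\<lambda>x. one_minus_pd2 L i G x s) k = of_real (1 + (of_int (k $ i))\<^sup>2) * fcoef L (\<lambda>x. G x s) k"
proof -
  let ?a = "2 * pi * of_int (k $ i) / L :: real"
  note sm = smooth_st_pd[OF assms(1,3), of i]
  have 1: "fcoef L (\<lambda>x. pd i (\<lambda>y. pd i (\<lambda>y. G y s) y) x) k = \<i> * of_real ?a * (\<i> * of_real ?a * fcoef L (\<lambda>x. G x s) k)"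
    using fcoef_pd_st[OF sm periodic_st_pd[OF assms(2)] assms(3-5)] fcoef_pd_st[OF assms]
    by (simp only:)
  have "fcoef L (\<lambda>x. one_minus_pd2 L i G x s) k = fcoef L (\<lambda>x. G x s) k
      - of_real ((L / (2 * pi))\<^sup>2) * (\<i> * of_real ?a * (\<i> * of_real ?a * fcoef L (\<lambda>x. G x s) k))"
    unfolding one_minus_pd2_def 1[symmetric]
    by (rule fcoef_diff_mult[OF assms(4) smooth_st_continuous_slice[OF assms(1,5)]
          smooth_st_continuous_slice[OF smooth_st_pd[OF sm assms(3)] assms(5)]])
  also have "\<dots> = fcoef L (\<lambda>x. G x s) k + of_real ((L / (2 * pi))\<^sup>2 * (?a * ?a)) * fcoef L (\<lambda>x. G x s) k"
  proof -
    have "X - of_real c * (\<i> * of_real d * (\<i> * of_real d * X)) = X + of_real (c * (d * d)) * X"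
      for X and c d :: real by (simp add: algebra_simps)
    then show ?thesis .
  qed
  also have "(L / (2 * pi))\<^sup>2 * (?a * ?a) = (of_int (k $ i))\<^sup>2"
    using assms(4) by (simp add: power2_eq_square field_simps)
  finally show ?thesis by (simp add: algebra_simps)
qed

lemma smooth_st_bounded_cell:
  fixes G :: "real^3 \<Rightarrow> real \<Rightarrow> real"
  assumes "smooth_st T G"
  shows "\<exists>C. \<forall>x\<in>cell L. \<forall>s\<in>{0..T}. \<bar>G x s\<bar> \<le> C"
proof -
  have "continuous_on (cell L \<times> {0..T}) (\<lambda>(x, s). G x s)"
    by (rule continuous_on_subset[OF smooth_st_continuous[OF assms]]) auto
  then have "bounded ((\<lambda>(x, s). G x s) ` (cell L \<times> {0..T}))"
    by (intro compact_imp_bounded compact_continuous_image compact_Times) (auto simp: cell_def)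
  then show ?thesis unfolding bounded_iff by force
qed

lemma prod_UNIV_3: "(\<Prod>i\<in>(UNIV :: 3 set). f i) = f 1 * f 2 * f 3"
  for f :: "3 \<Rightarrow> 'a::comm_monoid_mult"
  unfolding UNIV_3 by (simp add: ac_simps)

text \<open>Applying \<open>one_minus_pd2\<close> in the three directions multiplies the coefficient
  by the reciprocal of \<open>cweight k\<close>, and the coefficients of the result are bounded by
  its supremum. The supremum is taken over the compact product of the cell and
  \<open>{0..T}\<close>, which makes \<open>C\<close> independent of time.\<close>

lemma fcoef_decay:
  assumes "smooth_st T G" "periodic_st L G" "T > 0" "L > 0"
  shows "\<exists>C. \<forall>s\<in>{0..T}. \<forall>k::int^3. norm (fcoef L (\<lambda>x. G x s) k) \<le> C * cweight k"
proof -
  let ?G1 = "one_minus_pd2 L 1 G" let ?G2 = "one_minus_pd2 L 2 ?G1" let ?G3 = "one_minus_pd2 L 3 ?G2"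
  note sm = smooth_st_one_minus_pd2[OF _ assms(3)] and per = periodic_st_one_minus_pd2
  obtain C where C: "\<forall>x\<in>cell L. \<forall>s\<in>{0..T}. \<bar>?G3 x s\<bar> \<le> C"
    using smooth_st_bounded_cell[OF sm[OF sm[OF sm[OF assms(1)]]], where L=L] by (rule exE)
  show ?thesis
  proof (intro exI[of _ C] ballI allI)
    fix s and k :: "int^3" assume s: "s \<in> {0..T}"
    let ?w = "\<lambda>i. 1 + (real_of_int (k $ i))\<^sup>2"
    have w: "?w i > 0" for i by (rule add_pos_nonneg) auto
    have "fcoef L (\<lambda>x. ?G3 x s) k = of_real (?w 3) * (of_real (?w 2) * (of_real (?w 1) * fcoef L (\<lambda>x. G x s) k))"
      unfolding fcoef_one_minus_pd2[OF sm[OF sm[OF assms(1)]] per[OF per[OF assms(2)]] assms(3,4) s]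
        fcoef_one_minus_pd2[OF sm[OF assms(1)] per[OF assms(2)] assms(3,4) s]
        fcoef_one_minus_pd2[OF assms s] by (rule refl)
    then have "norm (fcoef L (\<lambda>x. ?G3 x s) k) = ?w 3 * (?w 2 * (?w 1 * norm (fcoef L (\<lambda>x. G x s) k)))"
      using w by (simp only: norm_mult norm_of_real abs_of_pos)
    moreover have "norm (fcoef L (\<lambda>x. ?G3 x s) k) \<le> C"
      by (rule norm_fcoef_le[OF assms(4) smooth_st_continuous_slice[OF sm[OF sm[OF sm[OF assms(1)]]] s]])
         (use C s in blast)
    ultimately have "?w 3 * (?w 2 * (?w 1 * norm (fcoef L (\<lambda>x. G x s) k))) \<le> C" by (simp only:)
    then have le: "norm (fcoef L (\<lambda>x. G x s) k) * (?w 1 * ?w 2 * ?w 3) \<le> C"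
      unfolding mult.commute[of "norm (fcoef L (\<lambda>x. G x s) k)"] mult.assoc mult.left_commute[of "?w 1" "?w 2"]
        mult.left_commute[of "?w 1" "?w 3"] mult.left_commute[of "?w 2" "?w 3"] .
    have pos: "?w 1 * ?w 2 * ?w 3 > 0" by (intro mult_pos_pos w)
    have "cweight k = 1 / (?w 1 * ?w 2 * ?w 3)"
      unfolding cweight_def prod_UNIV_3 times_divide_times_eq by (simp only: mult_1_left)
    then have "C * cweight k = C / (?w 1 * ?w 2 * ?w 3)" by (simp only: times_divide_eq_right mult_1_right)
    then show "norm (fcoef L (\<lambda>x. G x s) k) \<le> C * cweight k"
      using pos_le_divide_eq[OF pos, THEN iffD2, OF le] by (simp only:)
  qed
qed

subsection \<open>The inverse square root of the Laplacian\<close>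

lemma knorm_ge_1: "k \<noteq> 0 \<Longrightarrow> knorm k \<ge> 1"
proof -
  assume "k \<noteq> 0"
  then obtain i where "k $ i \<noteq> 0" by (auto simp: vec_eq_iff)
  then have "1 \<le> \<bar>k $ i\<bar>" by simp
  then have "1 \<le> (k $ i)\<^sup>2" using power_mono[of 1 "\<bar>k $ i\<bar>" 2] by simp
  then have "1 \<le> (of_int (k $ i) :: real)\<^sup>2" by (metis of_int_1_le_iff of_int_power)
  also have "\<dots> \<le> (\<Sum>i\<in>UNIV. (of_int (k $ i))\<^sup>2)"
    by (rule member_le_sum) auto
  finally show ?thesis by (simp add: knorm_def)
qed

lemma knorm_minus: "knorm (- k) = knorm k"
  by (simp add: knorm_def)

text \<open>Since \<open>knorm k \<ge> 1\<close> for nonzero \<open>k\<close>, the symbol is at most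
  \<open>L / (2 * pi)\<close> and the series inherits the summable majorant of the coefficients of
  \<open>G\<close>. Uniform convergence in \<open>(x, s)\<close> gives continuity of the sum and
  permits termwise integration against a character.\<close>

lemma inv_sqrt_series:
  fixes G :: "real^3 \<Rightarrow> real \<Rightarrow> real"
  assumes "smooth_st T G" "periodic_st L G" "T > 0" "L > 0"
  defines "a \<equiv> \<lambda>s k. complex_of_real (L / (2 * pi * knorm k)) * fcoef L (\<lambda>y. G y s) k"
  defines "g \<equiv> \<lambda>x s. Re (\<Sum>\<^sub>\<infinity>k\<in>UNIV - {0}. a s k * fchar L k x)"
  shows "continuous_on (UNIV \<times> {0..T}) (\<lambda>(x, s). g x s)"
    and "s \<in> {0..T} \<Longrightarrow> k \<noteq> 0 \<Longrightarrow> fcoef L (\<lambda>x. g x s) k = a s k"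
proof -
  obtain C where C: "\<And>s k. s \<in> {0..T} \<Longrightarrow> norm (fcoef L (\<lambda>x. G x s) k) \<le> C * cweight k"
    using fcoef_decay[OF assms(1-4)] by blast
  have bound: "norm (a s k) \<le> (L / (2 * pi)) * (C * cweight k)" if "s \<in> {0..T}" "k \<in> UNIV - {0}" for s k
  proof -
    have "L / (2 * pi * knorm k) \<le> L / (2 * pi)"
      using knorm_ge_1[of k] that \<open>L > 0\<close> by (intro divide_left_mono) (auto simp: mult_le_cancel_left1)
    moreover have "0 \<le> L / (2 * pi * knorm k)" using knorm_ge_1[of k] that \<open>L > 0\<close> by simp
    ultimately show ?thesis unfolding a_def norm_mult norm_of_real
      using C[OF that(1), of k] by (intro mult_mono) auto
  qed
  have sum: "(\<lambda>k. (L / (2 * pi)) * (C * cweight k)) summable_on UNIV - {0}"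
    by (intro summable_on_cmult_right cweight_summable)
  let ?S = "\<lambda>x s. \<Sum>\<^sub>\<infinity>k\<in>UNIV - {0}. a s k * fchar L k x"
  have ul: "uniform_limit (UNIV \<times> {0..T}) (\<lambda>F z. \<Sum>k\<in>F. a (snd z) k * fchar L k (fst z)) (\<lambda>z. ?S (fst z) (snd z))
      (finite_subsets_at_top (UNIV - {0}))"
    by (rule Weierstrass_m_test_general[OF _ sum]) (use bound in \<open>auto simp: norm_mult\<close>)
  have ca: "continuous_on {0..T} (\<lambda>s. a s k)" for k
    unfolding a_def fcoef_eq
  proof (intro continuous_intros continuous_on_integral_cell)
    show "continuous_on (UNIV \<times> {0..T}) (\<lambda>(x, s). complex_of_real (G x s) * fchar L (- k) x)"
      using smooth_st_continuous[OF assms(1)] by (auto simp: split_beta intro!: continuous_intros)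
  qed
  have "continuous_on (UNIV \<times> {0..T}) (\<lambda>z. ?S (fst z) (snd z))"
  proof (rule uniform_limit_theorem[OF _ ul])
    show "\<forall>\<^sub>F F in finite_subsets_at_top (UNIV - {0}). continuous_on (UNIV \<times> {0..T}) (\<lambda>z. \<Sum>k\<in>F. a (snd z) k * fchar L k (fst z))"
      by (intro always_eventually allI continuous_intros continuous_on_compose2[OF ca]) auto
  qed simp
  then show "continuous_on (UNIV \<times> {0..T}) (\<lambda>(x, s). g x s)"
    unfolding g_def split_beta by (intro continuous_on_Re)
  assume s: "s \<in> {0..T}" 
  have cS: "continuous_on UNIV (\<lambda>x. ?S x s)"
    by (rule continuous_on_compose2[OF \<open>continuous_on (UNIV \<times> {0..T}) (\<lambda>z. ?S (fst z) (snd z))\<close>,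
          of UNIV "\<lambda>x. (x, s)", unfolded fst_conv snd_conv])
       (use s in \<open>auto intro!: continuous_on_Pair continuous_on_id continuous_on_const\<close>)
  have cG: "continuous_on UNIV (\<lambda>x. G x s)" by (rule smooth_st_continuous_slice[OF assms(1) s])
  have coef: "((\<lambda>x. ?S x s * fchar L (- k) x) has_integral of_real (L ^ 3) * a s k) (cell L)" if "k \<noteq> 0" for k
  proof -
    have "uniform_limit (cbox 0 (\<chi> i. L)) (\<lambda>F x. \<Sum>l\<in>F. a s l * fchar L (l - k) x)
        (\<lambda>x. \<Sum>\<^sub>\<infinity>l\<in>UNIV - {0}. a s l * fchar L (l - k) x) (finite_subsets_at_top (UNIV - {0}))"
      by (rule Weierstrass_m_test_general[OF _ sum]) (use bound s in \<open>auto simp: norm_mult\<close>)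
    then obtain I J where IJ: "\<And>F. ((\<lambda>x. \<Sum>l\<in>F. a s l * fchar L (l - k) x) has_integral I F) (cbox 0 (\<chi> i. L))"
        "((\<lambda>x. \<Sum>\<^sub>\<infinity>l\<in>UNIV - {0}. a s l * fchar L (l - k) x) has_integral J) (cbox 0 (\<chi> i. L))"
        "(I \<longlongrightarrow> J) (finite_subsets_at_top (UNIV - {0}))"
      by (rule uniform_limit_integral_cbox) (auto intro!: continuous_intros)
    have "I F = of_real (L ^ 3) * a s k" if "finite F" "k \<in> F" for F
    proof -
      have "((\<lambda>x. \<Sum>l\<in>F. a s l * fchar L (l - k) x) has_integral
          (\<Sum>l\<in>F. a s l * (if l - k = 0 then of_real (L ^ 3) else 0))) (cell L)"
        by (intro has_integral_sum has_integral_mult_right has_integral_fchar that assms)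
      then have "I F = (\<Sum>l\<in>F. a s l * (if l - k = 0 then of_real (L ^ 3) else 0))"
        by (rule has_integral_unique[OF IJ(1)[of F, folded cell_def]])
      also have "\<dots> = (\<Sum>l\<in>F. if l = k then of_real (L ^ 3) * a s k else 0)"
        by (rule sum.cong) auto
      finally show ?thesis using that by simp
    qed
    \<comment> \<open>By orthogonality the integral of a partial sum no longer changes once
      \<open>k\<close> belongs to the index set, so the limit is reached exactly.\<close>
    then have "\<forall>\<^sub>F F in finite_subsets_at_top (UNIV - {0}). I F = of_real (L ^ 3) * a s k"
      unfolding eventually_finite_subsets_at_top using that
      by (intro exI[of _ "{k}"]) auto
    then have "(I \<longlongrightarrow> of_real (L ^ 3) * a s k) (finite_subsets_at_top (UNIV - {0}))"
      by (rule tendsto_eventually)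
    then have "J = of_real (L ^ 3) * a s k"
      by (rule tendsto_unique[OF finite_subsets_at_top_neq_bot IJ(3)])
    moreover have "(\<Sum>\<^sub>\<infinity>l\<in>UNIV - {0}. a s l * fchar L (l - k) x) = ?S x s * fchar L (- k) x" for x
    proof -
      have "fchar L (l - k) x = fchar L l x * fchar L (- k) x" for l
        using fchar_add[of L l "- k" x] by simp
      then have "(\<Sum>\<^sub>\<infinity>l\<in>UNIV - {0}. a s l * fchar L (l - k) x)
          = (\<Sum>\<^sub>\<infinity>l\<in>UNIV - {0}. a s l * fchar L l x * fchar L (- k) x)"
        by (simp only: mult.assoc)
      also have "\<dots> = ?S x s * fchar L (- k) x" by (rule infsum_cmult_left')
      finally show ?thesis .
    qed
    ultimately show ?thesis using IJ(2) by (simp add: cell_def)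
  qed
  \<comment> \<open>\<open>G\<close> is real, so its coefficients are Hermitian, and the symbol is
    real and even. Hence the complex sum and its conjugate have the same coefficient at
    \<open>k\<close>, and taking the real part, their average, does not change it.\<close>
  have a_minus: "a s (- k) = cnj (a s k)" for k
    unfolding a_def using fcoef_minus[OF \<open>L > 0\<close> cG, of k] by (simp add: knorm_minus)
  show "fcoef L (\<lambda>x. g x s) k = a s k" if "k \<noteq> 0"
  proof -
    have "((\<lambda>x. cnj (?S x s * fchar L k x)) has_integral cnj (of_real (L ^ 3) * a s (- k))) (cell L)"
      using has_integral_cnj[THEN iffD2, OF coef[of "- k"]] that by (simp add: o_def)
    then have "((\<lambda>x. cnj (?S x s) * fchar L (- k) x) has_integral of_real (L ^ 3) * a s k) (cell L)"
      by (simp add: cnj_fchar a_minus)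
    from has_integral_mult_right[OF has_integral_add[OF coef[OF that] this], of "1 / 2"]
    have "((\<lambda>x. 1 / 2 * (?S x s * fchar L (- k) x + cnj (?S x s) * fchar L (- k) x)) has_integral
        of_real (L ^ 3) * a s k) (cell L)" by (simp add: mult.commute[of "a s k"])
    moreover have "1 / 2 * (z * w + cnj z * w) = of_real (Re z) * w" for z w :: complex
      using complex_add_cnj[of z] by (simp add: distrib_right[symmetric])
    ultimately have 1: "((\<lambda>x. of_real (g x s) * fchar L (- k) x) has_integral of_real (L ^ 3) * a s k) (cell L)"
      unfolding g_def by (simp only:)
    have "((\<lambda>x. of_real (g x s) * fchar L (- k) x) has_integral of_real (L ^ 3) * fcoef L (\<lambda>x. g x s) k) (cell L)"
      by (rule has_integral_fcoef[OF \<open>L > 0\<close>]) (unfold g_def, rule continuous_on_Re[OF cS])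
    from has_integral_unique[OF this 1] show ?thesis using \<open>L > 0\<close> by simp
  qed
qed

section \<open>Duality between the force and the velocity gradient\<close>

lemma young_mult:
  fixes \<nu> x y :: real
  assumes "\<nu> > 0"
  shows "y * x \<le> \<nu> * x\<^sup>2 + 1 / (4 * \<nu>) * y\<^sup>2"
proof -
  have "\<nu> * x\<^sup>2 + 1 / (4 * \<nu>) * y\<^sup>2 - y * x = (2 * \<nu> * x - y)\<^sup>2 / (4 * \<nu>)"
    using assms by (simp add: field_simps power2_eq_square)
  also have "\<dots> \<ge> 0" using assms by simp
  finally show ?thesis by simp
qed

text \<open>At a nonzero frequency with \<open>K = 2 * pi * knorm k / L\<close>, the product of the
  coefficients of \<open>h\<close> and \<open>u\<close> is rewritten by dividing the first by
  \<open>K\<close> and multiplying the second by \<open>K\<close>. The quotient is the coefficient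
  of \<open>g\<close>, and the square of the product is the sum of the squared coefficients of the
  derivatives \<open>u' i\<close>. Young's inequality separates the two, and Bessel's inequality
  bounds each sum by an integral. The frequency 0 contributes nothing because \<open>h\<close> has
  zero mean.\<close>

lemma integral_mult_le_dual:
  fixes h u g :: "real^3 \<Rightarrow> real" and u' :: "3 \<Rightarrow> real^3 \<Rightarrow> real"
  assumes L: "L > 0" and nu: "\<nu> > 0"
    and ch: "continuous_on UNIV h" and cu: "continuous_on UNIV u" and cg: "continuous_on UNIV g"
    and per: "\<And>x i. h (x + L *\<^sub>R axis i 1) = h x" and mean: "fcoef L h 0 = 0"
    and cu': "\<And>i. continuous_on UNIV (u' i)"
    and fu': "\<And>i k. fcoef L (u' i) k = \<i> * of_real (2 * pi * (k $ i) / L) * fcoef L u k"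
    and fg: "\<And>k. k \<noteq> 0 \<Longrightarrow> fcoef L g k = of_real (L / (2 * pi * knorm k)) * fcoef L h k"
  shows "integral (cell L) (\<lambda>x. h x * u x)
      \<le> \<nu> * (\<Sum>i\<in>UNIV. integral (cell L) (\<lambda>x. (u' i x)\<^sup>2)) + 1 / (4 * \<nu>) * integral (cell L) (\<lambda>x. (g x)\<^sup>2)"
proof (rule field_le_epsilon)
  fix \<epsilon> :: real assume "\<epsilon> > 0"
  obtain F where F: "finite F"
    "integral (cell L) (\<lambda>x. h x * u x) \<le> L ^ 3 * (\<Sum>k\<in>F. norm (fcoef L h k) * norm (fcoef L u k)) + \<epsilon>"
    using integral_mult_le_fcoef[OF L ch per cu \<open>\<epsilon> > 0\<close>] by metis
  have young: "norm (fcoef L h k) * norm (fcoef L u k)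
      \<le> \<nu> * (\<Sum>i\<in>UNIV. (norm (fcoef L (u' i) k))\<^sup>2) + 1 / (4 * \<nu>) * (norm (fcoef L g k))\<^sup>2" for k
  proof (cases "k = 0")
    case True
    then show ?thesis using nu by (simp add: mean sum_nonneg)
  next
    case False
    let ?K = "2 * pi * knorm k / L"
    have K: "?K > 0" using knorm_ge_1[OF False] L by simp
    have kn: "(knorm k)\<^sup>2 = (\<Sum>i\<in>UNIV. (of_int (k $ i))\<^sup>2)"
      unfolding knorm_def by (simp add: sum_nonneg)
    have "(\<Sum>i\<in>UNIV. (norm (fcoef L (u' i) k))\<^sup>2) = (\<Sum>i\<in>UNIV. (2 * pi / L)\<^sup>2 * (norm (fcoef L u k))\<^sup>2 * (of_int (k $ i))\<^sup>2)"
      using L by (simp add: fu' norm_mult norm_divide power_mult_distrib power_divide mult_ac)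
    also have "\<dots> = (2 * pi / L)\<^sup>2 * (norm (fcoef L u k))\<^sup>2 * (knorm k)\<^sup>2"
      by (simp only: sum_distrib_left[symmetric] kn)
    also have "\<dots> = (?K * norm (fcoef L u k))\<^sup>2"
      by (simp add: power_mult_distrib power_divide)
    finally have 1: "(\<Sum>i\<in>UNIV. (norm (fcoef L (u' i) k))\<^sup>2) = (?K * norm (fcoef L u k))\<^sup>2" .
    have gK: "norm (fcoef L g k) = norm (fcoef L h k) / ?K"
      using K L knorm_ge_1[OF False] by (simp add: fg[OF False] norm_mult norm_divide)
    have 2: "norm (fcoef L h k) * norm (fcoef L u k) = norm (fcoef L g k) * (?K * norm (fcoef L u k))"
    proof -
      have "b * c = a * (K * c)" if "a = b / K" "K > 0" for a b c K :: real using that by simp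
      then show ?thesis using gK K .
    qed
    show ?thesis unfolding 1 2 by (rule young_mult[OF nu])
  qed
  have "L ^ 3 * (\<Sum>k\<in>F. norm (fcoef L h k) * norm (fcoef L u k))
      \<le> L ^ 3 * (\<Sum>k\<in>F. \<nu> * (\<Sum>i\<in>UNIV. (norm (fcoef L (u' i) k))\<^sup>2) + 1 / (4 * \<nu>) * (norm (fcoef L g k))\<^sup>2)"
    using L by (intro mult_left_mono sum_mono young) auto
  also have "\<dots> = \<nu> * (\<Sum>i\<in>UNIV. L ^ 3 * (\<Sum>k\<in>F. (norm (fcoef L (u' i) k))\<^sup>2))
      + 1 / (4 * \<nu>) * (L ^ 3 * (\<Sum>k\<in>F. (norm (fcoef L g k))\<^sup>2))"
  proof -
    let ?n = "\<lambda>i k. (norm (fcoef L (u' i) k))\<^sup>2"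
    have "(\<Sum>i\<in>UNIV. L ^ 3 * (\<Sum>k\<in>F. ?n i k)) = L ^ 3 * (\<Sum>i\<in>UNIV. \<Sum>k\<in>F. ?n i k)"
      by (rule sum_distrib_left[symmetric])
    also have "\<dots> = L ^ 3 * (\<Sum>k\<in>F. \<Sum>i\<in>UNIV. ?n i k)"
      by (rule arg_cong[where f="(*) (L ^ 3)"], rule sum.swap)
    finally have swap: "(\<Sum>i\<in>UNIV. L ^ 3 * (\<Sum>k\<in>F. ?n i k)) = L ^ 3 * (\<Sum>k\<in>F. \<Sum>i\<in>UNIV. ?n i k)" .
    have "L ^ 3 * (\<Sum>k\<in>F. \<nu> * A k + c * B k) = \<nu> * (L ^ 3 * sum A F) + c * (L ^ 3 * sum B F)" for A B c
      by (simp add: sum.distrib sum_distrib_left[of \<nu> A, symmetric] sum_distrib_left[of c B, symmetric] distrib_left)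
    then show ?thesis unfolding swap .
  qed
  also have "\<dots> \<le> \<nu> * (\<Sum>i\<in>UNIV. integral (cell L) (\<lambda>x. (u' i x)\<^sup>2)) + 1 / (4 * \<nu>) * integral (cell L) (\<lambda>x. (g x)\<^sup>2)"
    using nu by (intro add_mono mult_left_mono sum_mono bessel L cu' cg F(1)) auto
  finally show "integral (cell L) (\<lambda>x. h x * u x) \<le> \<nu> * (\<Sum>i\<in>UNIV. integral (cell L) (\<lambda>x. (u' i x)\<^sup>2))
      + 1 / (4 * \<nu>) * integral (cell L) (\<lambda>x. (g x)\<^sup>2) + \<epsilon>"
    using F(2) by simp
qed

subsection \<open>Energy identities\<close>

lemma integral_cell_sum:
  fixes h :: "'i \<Rightarrow> real^3 \<Rightarrow> 'b::banach"
  assumes "finite A" "\<And>i. i \<in> A \<Longrightarrow> continuous_on UNIV (h i)"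
  shows "integral (cell L) (\<lambda>x. \<Sum>i\<in>A. h i x) = (\<Sum>i\<in>A. integral (cell L) (h i))"
  using assms by (intro integral_sum integrable_on_cell)

lemma integral_cell_divergence_zero:
  fixes h :: "3 \<Rightarrow> real^3 \<Rightarrow> real"
  assumes "L > 0" "\<And>i. continuous_on UNIV (h i)" "\<And>i x. h i (x + L *\<^sub>R axis i 1) = h i x"
    and "\<And>i x. ((\<lambda>t. h i (x + t *\<^sub>R axis i 1)) has_vector_derivative h' i x) (at 0)"
    and "\<And>i. continuous_on UNIV (h' i)"
  shows "integral (cell L) (\<lambda>x. \<Sum>i\<in>UNIV. h' i x) = 0"
proof -
  have "integral (cell L) (h' i) = 0" for i
    by (rule integral_cell_pd_zero[OF assms(1) assms(2)[of i] assms(3) assms(4) assms(5)])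
  then show ?thesis by (simp add: integral_cell_sum assms(5))
qed

context
  fixes T L s :: real and u :: "real^3 \<Rightarrow> real \<Rightarrow> real^3"
  assumes T: "T > 0" and L: "L > 0" and s: "s \<in> {0..T}"
    and u: "smooth_st T u" "periodic_st L u"
    and div: "\<And>x. divg (\<lambda>y. u y s) x = 0"
begin

private lemmas cont = smooth_st_continuous_slice[OF _ s]
private lemmas u_nth = smooth_st_nth[OF u(1)]
private lemmas c_u = cont[OF u(1)] and c_pd_u = cont[OF smooth_st_pd[OF u_nth T]]

text \<open>The divergence of \<open>p u\<close> is \<open>u \<bullet> grad p\<close> plus
  \<open>p\<close> times the divergence of \<open>u\<close>, which vanishes: pressure does no work
  on a solenoidal field.\<close>

lemma integral_inner_grad_zero:
  assumes p: "smooth_st T p" "periodic_st L p"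
  shows "integral (cell L) (\<lambda>x. u x s \<bullet> grad (\<lambda>y. p y s) x) = 0"
proof -
  let ?h' = "\<lambda>i x. p x s * pd i (\<lambda>y. u y s $ i) x + pd i (\<lambda>y. p y s) x * (u x s $ i)"
  have d: "((\<lambda>t. p (x + t *\<^sub>R axis i 1) s * (u (x + t *\<^sub>R axis i 1) s $ i)) has_vector_derivative ?h' i x) (at 0)" for i x
    using has_vector_derivative_mult[OF smooth_st_has_pd[OF p(1) T s, of x i] smooth_st_has_pd[OF u_nth T s, of x i i]]
    by simp
  have "integral (cell L) (\<lambda>x. \<Sum>i\<in>UNIV. ?h' i x) = 0"
    by (rule integral_cell_divergence_zero[OF L _ _ d])
       (use u(2) p(2) in \<open>auto intro!: continuous_intros c_u c_pd_u cont[OF p(1)] cont[OF smooth_st_pd[OF p(1) T]]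
          simp: periodic_st_def\<close>)
  moreover have "(\<Sum>i\<in>UNIV. ?h' i x) = u x s \<bullet> grad (\<lambda>y. p y s) x" for x
  proof -
    have "(\<Sum>i\<in>UNIV. p x s * pd i (\<lambda>y. u y s $ i) x) = p x s * divg (\<lambda>y. u y s) x"
      unfolding divg_def by (rule sum_distrib_left[symmetric])
    then show ?thesis
      by (simp add: div grad_def sum.distrib inner_vec_def mult_ac)
  qed
  ultimately show ?thesis by simp
qed

section \<open>Energy balance of a field \<open>w\<close> carried by \<open>u\<close>, applied later
  with \<open>w = u\<close> and with \<open>w = ell\<close>\<close>

context
  fixes w :: "real^3 \<Rightarrow> real \<Rightarrow> real^3"
  assumes w: "smooth_st T w" "periodic_st L w"
begin

private lemmas pd_w = smooth_st_pd[OF w(1) T]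
private lemmas c_w = cont[OF w(1)] and c_pd_w = cont[OF pd_w]
  and c_pd_pd_w = cont[OF smooth_st_pd[OF pd_w T]]

text \<open>For solenoidal \<open>u\<close>, twice the integrand is the divergence of the flux of
  the squared length of \<open>w\<close>, so transport conserves the energy of
  \<open>w\<close>.\<close>

lemma integral_inner_adv_zero: "integral (cell L) (\<lambda>x. w x s \<bullet> adv (\<lambda>y. u y s) (\<lambda>y. w y s) x) = 0"
proof -
  let ?h' = "\<lambda>i x. (u x s $ i) * (2 * (w x s \<bullet> pd i (\<lambda>y. w y s) x)) + pd i (\<lambda>y. u y s $ i) x * (w x s \<bullet> w x s)"
  have d: "((\<lambda>t. (u (x + t *\<^sub>R axis i 1) s $ i) * (w (x + t *\<^sub>R axis i 1) s \<bullet> w (x + t *\<^sub>R axis i 1) s))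
      has_vector_derivative ?h' i x) (at 0)" for i x
    using has_vector_derivative_mult[OF smooth_st_has_pd[OF u_nth T s, of x i i]
        bounded_bilinear.has_vector_derivative[OF bounded_bilinear_inner
          smooth_st_has_pd[OF w(1) T s, of x i] smooth_st_has_pd[OF w(1) T s, of x i]]]
    by (simp add: inner_commute)
  have "integral (cell L) (\<lambda>x. \<Sum>i\<in>UNIV. ?h' i x) = 0"
    by (rule integral_cell_divergence_zero[OF L _ _ d])
       (use u(2) w(2) in \<open>auto intro!: continuous_intros c_u c_w c_pd_w c_pd_u simp: periodic_st_def\<close>)
  moreover have "(\<Sum>i\<in>UNIV. ?h' i x) = 2 * (w x s \<bullet> adv (\<lambda>y. u y s) (\<lambda>y. w y s) x)" for x
  proof -
    have "(\<Sum>i\<in>UNIV. pd i (\<lambda>y. u y s $ i) x * (w x s \<bullet> w x s)) = divg (\<lambda>y. u y s) x * (w x s \<bullet> w x s)"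
      unfolding divg_def by (rule sum_distrib_right[symmetric])
    then show ?thesis
      by (simp add: div adv_def sum.distrib inner_sum_right sum_distrib_left mult_ac)
  qed
  ultimately show ?thesis by simp
qed

text \<open>The flux here has the components \<open>w \<bullet> pd i w\<close>; its divergence is
  the integrand on the left plus the squared gradient.\<close>

lemma integral_inner_lap: "integral (cell L) (\<lambda>x. w x s \<bullet> lap (\<lambda>y. w y s) x)
    = - (\<Sum>i\<in>UNIV. integral (cell L) (\<lambda>x. (norm (pd i (\<lambda>y. w y s) x))\<^sup>2))"
proof -
  let ?h' = "\<lambda>i x. w x s \<bullet> pd i (\<lambda>y. pd i (\<lambda>y. w y s) y) x + (norm (pd i (\<lambda>y. w y s) x))\<^sup>2"
  have d: "((\<lambda>t. w (x + t *\<^sub>R axis i 1) s \<bullet> pd i (\<lambda>y. w y s) (x + t *\<^sub>R axis i 1))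
      has_vector_derivative ?h' i x) (at 0)" for i x
    using bounded_bilinear.has_vector_derivative[OF bounded_bilinear_inner
          smooth_st_has_pd[OF w(1) T s, of x i] smooth_st_has_pd[OF pd_w T s, of i x i]]
    by (simp add: power2_norm_eq_inner)
  have "integral (cell L) (\<lambda>x. \<Sum>i\<in>UNIV. ?h' i x) = 0"
    by (rule integral_cell_divergence_zero[OF L _ _ d])
       (use w(2) periodic_st_pd[OF w(2)] in \<open>auto intro!: continuous_intros c_w c_pd_w c_pd_pd_w simp: periodic_st_def\<close>)
  moreover have "integral (cell L) (\<lambda>x. \<Sum>i\<in>UNIV. ?h' i x)
      = integral (cell L) (\<lambda>x. w x s \<bullet> lap (\<lambda>y. w y s) x + (\<Sum>i\<in>UNIV. (norm (pd i (\<lambda>y. w y s) x))\<^sup>2))"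
    by (simp add: sum.distrib lap_def inner_sum_right)
  moreover have "\<dots> = integral (cell L) (\<lambda>x. w x s \<bullet> lap (\<lambda>y. w y s) x)
      + integral (cell L) (\<lambda>x. \<Sum>i\<in>UNIV. (norm (pd i (\<lambda>y. w y s) x))\<^sup>2)"
    unfolding lap_def
    by (intro integral_add integrable_on_cell continuous_intros c_w c_pd_w c_pd_pd_w)
  moreover have "integral (cell L) (\<lambda>x. \<Sum>i\<in>UNIV. (norm (pd i (\<lambda>y. w y s) x))\<^sup>2)
      = (\<Sum>i\<in>UNIV. integral (cell L) (\<lambda>x. (norm (pd i (\<lambda>y. w y s) x))\<^sup>2))"
    by (intro integral_cell_sum continuous_intros c_pd_w) auto
  ultimately show ?thesis by linarith
qed

text \<open>The right-hand side \<open>F\<close> is kept abstract so that one identity serves both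
  equations: it becomes the force minus the pressure gradient for \<open>u\<close>, and
  \<open>- u\<close> for \<open>ell\<close>.\<close>

lemma energy_derivative:
  assumes F: "continuous_on UNIV F"
    and eq: "\<And>x. dt T w x s + adv (\<lambda>y. u y s) (\<lambda>y. w y s) x - \<nu> *\<^sub>R lap (\<lambda>y. w y s) x = F x"
  shows "((\<lambda>\<tau>. integral (cell L) (\<lambda>x. (norm (w x \<tau>))\<^sup>2)) has_real_derivative
      2 * integral (cell L) (\<lambda>x. w x s \<bullet> F x)
        - 2 * \<nu> * (\<Sum>i\<in>UNIV. integral (cell L) (\<lambda>x. (norm (pd i (\<lambda>y. w y s) x))\<^sup>2))) (at s within {0..T})"
proof -
  have "((\<lambda>\<tau>. integral (cell L) (\<lambda>x. w x \<tau> \<bullet> w x \<tau>)) has_real_derivative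
      integral (cell L) (\<lambda>x. 2 * (w x s \<bullet> dt T w x s))) (at s within {0..T})"
  proof (rule has_real_derivative_integral_cell[OF _ _ _ s])
    show "((\<lambda>\<tau>. w x \<tau> \<bullet> w x \<tau>) has_vector_derivative 2 * (w x s \<bullet> dt T w x s)) (at s within {0..T})"
      if "s \<in> {0..T}" for x s
      using bounded_bilinear.has_vector_derivative[OF bounded_bilinear_inner
          smooth_st_has_dt[OF w(1) T that, of x] smooth_st_has_dt[OF w(1) T that, of x]]
      by (simp add: inner_commute)
    note c = smooth_st_continuous[OF w(1), unfolded split_beta]
      smooth_st_continuous[OF smooth_st_dt[OF w(1) T], unfolded split_beta]
    show "continuous_on (UNIV \<times> {0..T}) (\<lambda>(x, s). w x s \<bullet> w x s)"
      unfolding split_beta by (intro continuous_on_inner c)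
    show "continuous_on (UNIV \<times> {0..T}) (\<lambda>(x, s). 2 * (w x s \<bullet> dt T w x s))"
      unfolding split_beta by (intro continuous_on_mult_left continuous_on_inner c)
  qed
  moreover have "integral (cell L) (\<lambda>x. 2 * (w x s \<bullet> dt T w x s))
     = integral (cell L) (\<lambda>x. 2 * (w x s \<bullet> F x) - 2 * (w x s \<bullet> adv (\<lambda>y. u y s) (\<lambda>y. w y s) x)
         + 2 * \<nu> * (w x s \<bullet> lap (\<lambda>y. w y s) x))"
  proof (rule arg_cong[where f="integral (cell L)"], rule ext)
    fix x
    have "dt T w x s = F x - adv (\<lambda>y. u y s) (\<lambda>y. w y s) x + \<nu> *\<^sub>R lap (\<lambda>y. w y s) x"
      unfolding eq[symmetric] by simp
    then show "2 * (w x s \<bullet> dt T w x s) = 2 * (w x s \<bullet> F x) - 2 * (w x s \<bullet> adv (\<lambda>y. u y s) (\<lambda>y. w y s) x)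
         + 2 * \<nu> * (w x s \<bullet> lap (\<lambda>y. w y s) x)"
      by (simp only: inner_add_right inner_diff_right inner_scaleR_right) (simp add: algebra_simps)
  qed
  moreover have "\<dots> = 2 * integral (cell L) (\<lambda>x. w x s \<bullet> F x)
       - 2 * integral (cell L) (\<lambda>x. w x s \<bullet> adv (\<lambda>y. u y s) (\<lambda>y. w y s) x)
       + 2 * \<nu> * integral (cell L) (\<lambda>x. w x s \<bullet> lap (\<lambda>y. w y s) x)"
  proof -
    have hF: "((\<lambda>x. w x s \<bullet> F x) has_integral integral (cell L) (\<lambda>x. w x s \<bullet> F x)) (cell L)"
      by (rule has_integral_cell) (intro continuous_intros c_w F)
    have hA: "((\<lambda>x. w x s \<bullet> adv (\<lambda>y. u y s) (\<lambda>y. w y s) x) has_integral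
        integral (cell L) (\<lambda>x. w x s \<bullet> adv (\<lambda>y. u y s) (\<lambda>y. w y s) x)) (cell L)"
      by (rule has_integral_cell, unfold adv_def) (intro continuous_intros c_w c_u c_pd_w)
    have hL: "((\<lambda>x. w x s \<bullet> lap (\<lambda>y. w y s) x) has_integral
        integral (cell L) (\<lambda>x. w x s \<bullet> lap (\<lambda>y. w y s) x)) (cell L)"
      by (rule has_integral_cell, unfold lap_def) (intro continuous_intros c_w c_pd_pd_w)
    show ?thesis
      by (rule integral_unique)
         (intro has_integral_add has_integral_diff has_integral_mult_right hF hA hL)
  qed
  ultimately show ?thesis
    by (simp add: integral_inner_adv_zero integral_inner_lap power2_norm_eq_inner)
qed

end

end

section \<open>Monotonicity on closed time intervals and the dual bound for vector fields\<close>

lemma nonincreasing_within: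
  fixes f :: "real \<Rightarrow> real"
  assumes "a \<le> b" and d: "\<And>x. x \<in> {a..b} \<Longrightarrow> (f has_real_derivative f' x) (at x within {a..b})"
    and "\<And>x. x \<in> {a..b} \<Longrightarrow> f' x \<le> 0"
  shows "f b \<le> f a"
proof (rule DERIV_nonpos_imp_decreasing_open[OF assms(1)])
  show "\<exists>y. (f has_real_derivative y) (at x) \<and> y \<le> 0" if "a < x" "x < b" for x
    using d[of x] assms(3)[of x] that by (auto simp: at_within_Icc_at)
  show "continuous_on {a..b} f"
    unfolding continuous_on_eq_continuous_within using DERIV_continuous d by blast
qed

lemma norm_vec_power2: "(norm (v :: real^3))\<^sup>2 = (\<Sum>j\<in>UNIV. (v $ j)\<^sup>2)"
  unfolding power2_norm_eq_inner inner_vec_def by (simp add: power2_eq_square)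

lemma inv_sqrt_neg_lap_nth:
  "inv_sqrt_neg_lap L g x $ j = Re (\<Sum>\<^sub>\<infinity>k\<in>UNIV - {0}.
      complex_of_real (L / (2 * pi * knorm k)) * fcoef L (\<lambda>y. g y $ j) k * fchar L k x)"
  by (simp add: inv_sqrt_neg_lap_def fchar_def)

lemma periodic_st_nth: "periodic_st L G \<Longrightarrow> periodic_st L (\<lambda>x s. G x s $ j)"
  by (simp add: periodic_st_def)

lemma continuous_inv_sqrt_neg_lap:
  assumes "smooth_st T f" "periodic_st L f" "T > 0" "L > 0"
  shows "continuous_on (UNIV \<times> {0..T}) (\<lambda>(x, s). inv_sqrt_neg_lap L (\<lambda>y. f y s) x)"
proof -
  have "continuous_on (UNIV \<times> {0..T}) (\<lambda>z. inv_sqrt_neg_lap L (\<lambda>y. f y (snd z)) (fst z) $ j)" for j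
    using inv_sqrt_series(1)[OF smooth_st_nth[OF assms(1)] periodic_st_nth[OF assms(2)] assms(3,4), of j,
        unfolded split_beta]
    unfolding inv_sqrt_neg_lap_nth .
  then have "continuous_on (UNIV \<times> {0..T}) (\<lambda>z. \<chi> j. inv_sqrt_neg_lap L (\<lambda>y. f y (snd z)) (fst z) $ j)"
    by (rule continuous_on_vec_lambda)
  then show ?thesis by (simp add: split_beta)
qed

text \<open>The operator acts on each component separately, so the scalar bound is applied to every
  component and summed. The zero mean of \<open>f\<close> removes the frequency 0, at which the
  operator has no symbol.\<close>

lemma integral_inner_le_dual:
  fixes f u :: "real^3 \<Rightarrow> real \<Rightarrow> real^3"
  assumes f: "smooth_st T f" "periodic_st L f" and mean: "integral (cell L) (\<lambda>x. f x s) = 0"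
    and u: "smooth_st T u" "periodic_st L u"
    and T: "T > 0" and L: "L > 0" and nu: "\<nu> > 0" and s: "s \<in> {0..T}"
  shows "integral (cell L) (\<lambda>x. u x s \<bullet> f x s)
     \<le> \<nu> * (\<Sum>i\<in>UNIV. integral (cell L) (\<lambda>x. (norm (pd i (\<lambda>y. u y s) x))\<^sup>2))
       + 1 / (4 * \<nu>) * integral (cell L) (\<lambda>x. (norm (inv_sqrt_neg_lap L (\<lambda>y. f y s) x))\<^sup>2)"
proof -
  let ?g = "\<lambda>x. inv_sqrt_neg_lap L (\<lambda>y. f y s) x"
  note cont = smooth_st_continuous_slice[OF _ s]
  have cg: "continuous_on UNIV ?g"
    by (rule continuous_on_compose2[OF continuous_inv_sqrt_neg_lap[OF f T L, unfolded split_beta], of UNIV "\<lambda>x. (x, s)",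
          unfolded fst_conv snd_conv])
       (use s in \<open>auto intro!: continuous_on_Pair continuous_on_id continuous_on_const\<close>)
  have cf: "continuous_on UNIV (\<lambda>x. f x s)" and cu: "continuous_on UNIV (\<lambda>x. u x s)"
    and cpd: "continuous_on UNIV (\<lambda>x. pd i (\<lambda>y. u y s) x)" for i
    by (rule cont[OF f(1)] cont[OF u(1)] cont[OF smooth_st_pd[OF u(1) T]])+
  have mean_nth: "fcoef L (\<lambda>x. f x s $ j) 0 = 0" for j
  proof -
    have "((\<lambda>x. f x s $ j) has_integral 0 $ j) (cell L)"
      using has_integral_linear[OF has_integral_cell[OF cf, of L] bounded_linear_vec_nth, of j] mean
      by (simp add: o_def)
    then have "((\<lambda>x. complex_of_real (f x s $ j)) has_integral of_real 0) (cell L)"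
      by (intro has_integral_of_real) simp
    then show ?thesis by (simp add: fcoef_eq integral_unique)
  qed
  have comp: "integral (cell L) (\<lambda>x. f x s $ j * u x s $ j)
     \<le> \<nu> * (\<Sum>i\<in>UNIV. integral (cell L) (\<lambda>x. (pd i (\<lambda>y. u y s) x $ j)\<^sup>2))
       + 1 / (4 * \<nu>) * integral (cell L) (\<lambda>x. (?g x $ j)\<^sup>2)" for j
  proof (rule integral_mult_le_dual[OF L nu])
    show "continuous_on UNIV (\<lambda>x. f x s $ j)" "continuous_on UNIV (\<lambda>x. u x s $ j)" "continuous_on UNIV (\<lambda>x. ?g x $ j)"
      by (intro continuous_on_component cf cu cg)+
    show "continuous_on UNIV (\<lambda>x. pd i (\<lambda>y. u y s) x $ j)" for i
      by (intro continuous_on_component cpd)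
    show "f (x + L *\<^sub>R axis i 1) s $ j = f x s $ j" for x i
      using f(2) by (simp add: periodic_st_def)
    show "fcoef L (\<lambda>x. f x s $ j) 0 = 0" by (rule mean_nth)
    show "fcoef L (\<lambda>x. pd i (\<lambda>y. u y s) x $ j) k = \<i> * of_real (2 * pi * (k $ i) / L) * fcoef L (\<lambda>x. u x s $ j) k" for i k
      using fcoef_pd_st[OF smooth_st_nth[OF u(1)] periodic_st_nth[OF u(2)] T L s, of i j k]
      unfolding pd_nth[OF u(1) T s] .
    show "fcoef L (\<lambda>x. ?g x $ j) k = of_real (L / (2 * pi * knorm k)) * fcoef L (\<lambda>x. f x s $ j) k" if "k \<noteq> 0" for k
      using inv_sqrt_series(2)[OF smooth_st_nth[OF f(1)] periodic_st_nth[OF f(2)] T L s that, of j]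
      unfolding inv_sqrt_neg_lap_nth .
  qed
  have "integral (cell L) (\<lambda>x. u x s \<bullet> f x s) = integral (cell L) (\<lambda>x. \<Sum>j\<in>UNIV. f x s $ j * u x s $ j)"
    by (simp add: inner_vec_def mult.commute)
  also have "\<dots> = (\<Sum>j\<in>UNIV. integral (cell L) (\<lambda>x. f x s $ j * u x s $ j))"
    by (intro integral_cell_sum continuous_intros continuous_on_component cf cu finite)
  also have "\<dots> \<le> (\<Sum>j\<in>UNIV. \<nu> * (\<Sum>i\<in>UNIV. integral (cell L) (\<lambda>x. (pd i (\<lambda>y. u y s) x $ j)\<^sup>2))
       + 1 / (4 * \<nu>) * integral (cell L) (\<lambda>x. (?g x $ j)\<^sup>2))"
    by (rule sum_mono) (rule comp)
  also have "\<dots> = \<nu> * (\<Sum>j\<in>UNIV. \<Sum>i\<in>UNIV. integral (cell L) (\<lambda>x. (pd i (\<lambda>y. u y s) x $ j)\<^sup>2))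
       + 1 / (4 * \<nu>) * (\<Sum>j\<in>UNIV. integral (cell L) (\<lambda>x. (?g x $ j)\<^sup>2))"
    unfolding sum.distrib by (simp only: sum_distrib_left)
  also have "(\<Sum>j\<in>UNIV. integral (cell L) (\<lambda>x. (?g x $ j)\<^sup>2)) = integral (cell L) (\<lambda>x. (norm (?g x))\<^sup>2)"
    unfolding norm_vec_power2
    by (rule integral_cell_sum[symmetric]) (auto intro!: continuous_on_power continuous_on_component cg)
  also have "(\<Sum>j\<in>UNIV. \<Sum>i\<in>UNIV. integral (cell L) (\<lambda>x. (pd i (\<lambda>y. u y s) x $ j)\<^sup>2))
      = (\<Sum>i\<in>UNIV. integral (cell L) (\<lambda>x. (norm (pd i (\<lambda>y. u y s) x))\<^sup>2))"
  proof -
    have "(\<Sum>j\<in>UNIV. integral (cell L) (\<lambda>x. (pd i (\<lambda>y. u y s) x $ j)\<^sup>2))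
        = integral (cell L) (\<lambda>x. (norm (pd i (\<lambda>y. u y s) x))\<^sup>2)" for i
      unfolding norm_vec_power2
      by (rule integral_cell_sum[symmetric]) (auto intro!: continuous_on_power continuous_on_component cpd)
    then show ?thesis by (subst sum.swap) (simp only:)
  qed
  finally show ?thesis .
qed

text \<open>The pointwise bound of the squared distance by \<open>?h\<close> holds on
  \<open>S\<close> only, but \<open>?h\<close> is nonnegative, so its integral may be extended to
  all pairs. There it is explicit: each of the two variables contributes \<open>3 * L ^ 3\<close>
  times the integral of the squared length of \<open>l\<close>.\<close>

lemma pair_dispersion_le:
  fixes l :: "real^3 \<Rightarrow> real^3"
  assumes L: "L > 0" and cont: "continuous_on UNIV l"
  shows "pair_dispersion L \<delta> (\<lambda>x. x + l x) \<le> 3 * \<delta>\<^sup>2 + 6 / L ^ 3 * integral (cell L) (\<lambda>x. (norm (l x))\<^sup>2)"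
proof -
  define S where "S = {z :: (real^3) \<times> (real^3). fst z \<in> cell L \<and> snd z \<in> cell L \<and>
    norm ((fst z + l (fst z)) - (snd z + l (snd z))) \<le> \<delta>}"
  define V where "V = integral (cell L) (\<lambda>x. (norm (l x))\<^sup>2)"
  let ?B = "cbox (0, 0) (\<chi> i. L, \<chi> i. L) :: ((real^3) \<times> (real^3)) set"
  let ?h = "\<lambda>z. 3 * \<delta>\<^sup>2 + 3 * (norm (l (fst z)))\<^sup>2 + 3 * (norm (l (snd z)))\<^sup>2"
  have V: "((\<lambda>x. (norm (l x))\<^sup>2) has_integral V) (cell L)"
    unfolding V_def by (rule has_integral_cell) (intro continuous_intros cont)
  have V0: "V \<ge> 0" by (rule has_integral_nonneg[OF V]) simp
  have const: "((\<lambda>x :: real^3. c) has_integral L ^ 3 * c) (cell L)" for c :: real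
    using has_integral_const[of c "0 :: real^3" "\<chi> i. L", folded cell_def] content_cell[of L] L by simp
  have ch: "continuous_on A ?h" for A
    by (intro continuous_intros continuous_on_compose2[OF cont]) auto
  have h0: "?h z \<ge> 0" for z by simp
  have "integral ?B ?h = integral (cell L) (\<lambda>x. integral (cell L) (\<lambda>y. ?h (x, y)))"
    unfolding cell_def by (rule integral_prod_continuous[OF ch])
  also have "\<dots> = integral (cell L) (\<lambda>x. L ^ 3 * (3 * \<delta>\<^sup>2 + 3 * (norm (l x))\<^sup>2) + 3 * V)"
    by (simp only: fst_conv snd_conv)
       (intro arg_cong[where f="integral (cell L)"] ext integral_unique has_integral_add has_integral_mult_right V const)
  also have "\<dots> = L ^ 3 * (L ^ 3 * (3 * \<delta>\<^sup>2) + 3 * V) + L ^ 3 * (3 * V)"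
    by (intro integral_unique has_integral_add has_integral_mult_right V const)
  finally have Bh: "integral ?B ?h = L ^ 6 * (3 * \<delta>\<^sup>2) + 6 * L ^ 3 * V"
    by (simp add: algebra_simps power_add[symmetric])
  have le: "(norm (fst z - snd z))\<^sup>2 \<le> ?h z" if "z \<in> S" for z
  proof -
    define a b c where "a = norm ((fst z + l (fst z)) - (snd z + l (snd z)))" and "b = norm (l (fst z))" and "c = norm (l (snd z))"
    have "norm (fst z - snd z) = norm (((fst z + l (fst z)) - (snd z + l (snd z))) - l (fst z) + l (snd z))"
      by (simp add: algebra_simps)
    also have "\<dots> \<le> a + b + c"
      unfolding a_def b_def c_def by (rule order_trans[OF norm_triangle_ineq add_right_mono[OF norm_triangle_ineq4]])
    also have "\<dots> \<le> \<delta> + b + c" using that by (simp add: S_def a_def)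
    finally have "(norm (fst z - snd z))\<^sup>2 \<le> (\<delta> + b + c)\<^sup>2" by (rule power_mono) simp
    also have "\<dots> \<le> 3 * \<delta>\<^sup>2 + 3 * b\<^sup>2 + 3 * c\<^sup>2"
    proof -
      \<comment> \<open>The sum of these squares is exactly the difference of the two sides.\<close>
      have "0 \<le> (\<delta> - b)\<^sup>2 + (b - c)\<^sup>2 + (\<delta> - c)\<^sup>2" by simp
      then show ?thesis by (simp add: power2_eq_square algebra_simps)
    qed
    finally show ?thesis by (simp add: b_def c_def)
  qed
  have "S \<subseteq> ?B" by (auto simp: S_def cell_def)
  have "integral S (\<lambda>z. (norm (fst z - snd z))\<^sup>2) \<le> integral ?B ?h"
  proof (cases "(\<lambda>z. (norm (fst z - snd z))\<^sup>2) integrable_on S")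
    case True
    then have "((\<lambda>z. if z \<in> S then (norm (fst z - snd z))\<^sup>2 else 0) has_integral integral S (\<lambda>z. (norm (fst z - snd z))\<^sup>2)) ?B"
      by (intro has_integral_restrict[OF \<open>S \<subseteq> ?B\<close>, THEN iffD2] integrable_integral)
    moreover have "(?h has_integral integral ?B ?h) ?B"
      by (intro integrable_integral integrable_continuous ch)
    ultimately show ?thesis
      by (rule has_integral_le) (use le h0 in auto)
  next
    \<comment> \<open>The integral of a non-integrable function is 0 by convention, and the bound is
      nonnegative; the case split thus replaces a proof that the integrand is integrable on
      \<open>S\<close>.\<close>
    case False
    then show ?thesis unfolding Bh using L V0 by (simp add: not_integrable_integral)
  qed
  then have "(1 / L ^ 6) * integral S (\<lambda>z. (norm (fst z - snd z))\<^sup>2) \<le> (1 / L ^ 6) * (L ^ 6 * (3 * \<delta>\<^sup>2) + 6 * L ^ 3 * V)"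
    unfolding Bh using L by (intro mult_left_mono) auto
  also have "\<dots> = 3 * \<delta>\<^sup>2 + 6 / L ^ 3 * V"
    using L by (simp add: field_simps power_add[symmetric])
  finally show ?thesis unfolding pair_dispersion_def S_def V_def .
qed

section \<open>Energy bounds for \<open>u\<close> and \<open>ell\<close>, and the final
  estimate\<close>

theorem theorem2:
  fixes \<nu> L T \<delta>0 :: real
    and u f ell :: "real^3 \<Rightarrow> real \<Rightarrow> real^3" and p :: "real^3 \<Rightarrow> real \<Rightarrow> real"
  assumes "\<nu> > 0" "L > 0" "T > 0" "\<delta>0 > 0"
    and f_smooth: "smooth_on (UNIV \<times> {0..T}) (\<lambda>z. f (fst z) (snd z))"
    and f_per: "periodic_st L f"
    and f_mean: "\<forall>s\<in>{0..T}. integral (cell L) (\<lambda>x. f x s) = 0"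
    and u_smooth: "smooth_on (UNIV \<times> {0..T}) (\<lambda>z. u (fst z) (snd z))"
    and p_smooth: "smooth_on (UNIV \<times> {0..T}) (\<lambda>z. p (fst z) (snd z))"
    and u_per: "periodic_st L u" and p_per: "periodic_st L p"
    and NS: "\<forall>x. \<forall>s\<in>{0..T}.
              dt T u x s + adv (\<lambda>y. u y s) (\<lambda>y. u y s) x - \<nu> *\<^sub>R lap (\<lambda>y. u y s) x
                + grad (\<lambda>y. p y s) x = f x s"
    and incompr: "\<forall>x. \<forall>s\<in>{0..T}. divg (\<lambda>y. u y s) x = 0"
    and l_smooth: "smooth_on (UNIV \<times> {0..T}) (\<lambda>z. ell (fst z) (snd z))"
    and l_per: "periodic_st L ell"
    and l_eq: "\<forall>x. \<forall>s\<in>{0..T}.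
              dt T ell x s + adv (\<lambda>y. u y s) (\<lambda>y. ell y s) x - \<nu> *\<^sub>R lap (\<lambda>y. ell y s) x + u x s = 0"
    and l_init: "\<forall>x. ell x 0 = 0"
  shows "pair_dispersion L \<delta>0 (\<lambda>x. x + ell x T)
     \<le> 3 * \<delta>0^2
       + 24 * ((1 / (2 * L^3)) * integral (cell L) (\<lambda>x. (norm (u x 0))^2)) * T^2
       + 6 * ((1 / (\<nu> * T)) * integral {0..T}
               (\<lambda>s. (1 / L^3) * integral (cell L) (\<lambda>x. (norm (inv_sqrt_neg_lap L (\<lambda>y. f y s) x))^2))) * T^3"
proof -
  have f: "smooth_st T f" and u: "smooth_st T u" and p: "smooth_st T p" and l: "smooth_st T ell"
    using f_smooth u_smooth p_smooth l_smooth by (simp_all add: smooth_st_def)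
  note T = \<open>T > 0\<close> and L = \<open>L > 0\<close> and nu = \<open>\<nu> > 0\<close>
  define U where "U s = integral (cell L) (\<lambda>x. (norm (u x s))\<^sup>2)" for s
  define V where "V s = integral (cell L) (\<lambda>x. (norm (ell x s))\<^sup>2)" for s
  define G where "G s = integral (cell L) (\<lambda>x. (norm (inv_sqrt_neg_lap L (\<lambda>y. f y s) x))\<^sup>2)" for s
  define Du where "Du s = (\<Sum>i\<in>UNIV. integral (cell L) (\<lambda>x. (norm (pd i (\<lambda>y. u y s) x))\<^sup>2))" for s
  define Dl where "Dl s = (\<Sum>i\<in>UNIV. integral (cell L) (\<lambda>x. (norm (pd i (\<lambda>y. ell y s) x))\<^sup>2))" for s
  have int0: "integral (cell L) h \<ge> 0" if "\<And>x. h x \<ge> 0" for h :: "real^3 \<Rightarrow> real"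
    using that by (cases "h integrable_on cell L") (auto intro: integral_nonneg simp: not_integrable_integral)
  have D0: "Dl s \<ge> 0" for s
    unfolding Dl_def by (intro sum_nonneg int0) simp
  have contG: "continuous_on {0..T} G"
    unfolding G_def
    using continuous_inv_sqrt_neg_lap[OF f f_per T L]
    by (intro continuous_on_integral_cell) (auto simp: split_beta intro!: continuous_intros)
  have G0: "G s \<ge> 0" for s
    unfolding G_def by (rule int0) simp
  define M where "M = U 0 + 1 / (2 * \<nu>) * integral {0..T} G"
  have U_le: "U s \<le> M" if s: "s \<in> {0..T}" for s
  proof -
    define U' where "U' s = 2 * integral (cell L) (\<lambda>x. u x s \<bullet> (f x s - grad (\<lambda>y. p y s) x)) - 2 * \<nu> * Du s" for s
    have dU: "(U has_real_derivative U' r) (at r within {0..T})" if r: "r \<in> {0..T}" for r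
      unfolding U_def[abs_def] U'_def Du_def
    proof (rule energy_derivative[OF T L r u u_per _ u u_per])
      show "continuous_on UNIV (\<lambda>x. f x r - grad (\<lambda>y. p y r) x)"
        unfolding grad_def
        by (intro continuous_on_diff continuous_on_vec_lambda smooth_st_continuous_slice[OF f r]
            smooth_st_continuous_slice[OF smooth_st_pd[OF p T] r])
      show "dt T u x r + adv (\<lambda>y. u y r) (\<lambda>y. u y r) x - \<nu> *\<^sub>R lap (\<lambda>y. u y r) x = f x r - grad (\<lambda>y. p y r) x" for x
        using NS[rule_format, OF r, of x] by (simp add: algebra_simps)
    qed (use incompr r in auto)
    \<comment> \<open>The energy \<open>U\<close> omits the factor 1/2, so power and dissipation
      enter its derivative doubled. The dual bound cancels the dissipation completely, and its
      \<open>1 / (4 * \<nu>)\<close> becomes \<open>1 / (2 * \<nu>)\<close>.\<close>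
    have U'_le: "U' r \<le> 1 / (2 * \<nu>) * G r" if r: "r \<in> {0..T}" for r
    proof -
      have "integral (cell L) (\<lambda>x. u x r \<bullet> (f x r - grad (\<lambda>y. p y r) x))
          = integral (cell L) (\<lambda>x. u x r \<bullet> f x r - u x r \<bullet> grad (\<lambda>y. p y r) x)"
        by (simp add: inner_diff_right)
      also have "\<dots> = integral (cell L) (\<lambda>x. u x r \<bullet> f x r) - integral (cell L) (\<lambda>x. u x r \<bullet> grad (\<lambda>y. p y r) x)"
        unfolding grad_def
        by (intro integral_diff integrable_on_cell continuous_on_inner continuous_on_vec_lambda smooth_st_continuous_slice[OF f r]
            smooth_st_continuous_slice[OF u r] smooth_st_continuous_slice[OF smooth_st_pd[OF p T] r])
      also have "integral (cell L) (\<lambda>x. u x r \<bullet> grad (\<lambda>y. p y r) x) = 0"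
        by (rule integral_inner_grad_zero[OF T L r u u_per _ p p_per]) (use incompr r in auto)
      finally have "U' r = 2 * (integral (cell L) (\<lambda>x. u x r \<bullet> f x r) - \<nu> * Du r)"
        by (simp add: U'_def)
      also have "\<dots> \<le> 2 * (1 / (4 * \<nu>) * G r)"
        using integral_inner_le_dual[OF f f_per f_mean[rule_format, OF r] u u_per T L nu r]
        by (simp add: Du_def G_def)
      finally show ?thesis by simp
    qed
    \<comment> \<open>Subtracting the primitive of the bound turns the differential inequality into
      monotonicity; continuity of \<open>G\<close> makes the primitive differentiable.\<close>
    define P where "P r = U r - 1 / (2 * \<nu>) * integral {0..r} G" for r
    have "P s \<le> P 0"
    proof (rule nonincreasing_within[of 0 s P "\<lambda>r. U' r - 1 / (2 * \<nu>) * G r"])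
      fix r assume "r \<in> {0..s}"
      then have r: "r \<in> {0..T}" using s by auto
      have "(P has_real_derivative U' r - 1 / (2 * \<nu>) * G r) (at r within {0..T})"
        unfolding P_def[abs_def]
        by (intro DERIV_diff DERIV_cmult dU r integral_has_real_derivative contG)
      then show "(P has_real_derivative U' r - 1 / (2 * \<nu>) * G r) (at r within {0..s})"
        by (rule has_field_derivative_subset) (use s in auto)
      show "U' r - 1 / (2 * \<nu>) * G r \<le> 0" using U'_le[OF r] by simp
    qed (use s in auto)
    then have "U s \<le> U 0 + 1 / (2 * \<nu>) * integral {0..s} G" by (simp add: P_def)
    moreover have "integral {0..s} G \<le> integral {0..T} G"
      using s by (intro integral_subset_le integrable_continuous_interval continuous_on_subset[OF contG])
        (auto simp: G0)
    then have "1 / (2 * \<nu>) * integral {0..s} G \<le> 1 / (2 * \<nu>) * integral {0..T} G"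
      using nu by (intro mult_left_mono) auto
    ultimately show ?thesis unfolding M_def by linarith
  qed
  define V' where "V' s = 2 * integral (cell L) (\<lambda>x. ell x s \<bullet> - u x s) - 2 * \<nu> * Dl s" for s
  have dV: "(V has_real_derivative V' r) (at r within {0..T})" if r: "r \<in> {0..T}" for r
    unfolding V_def[abs_def] V'_def Dl_def
  proof (rule energy_derivative[OF T L r u u_per _ l l_per])
    show "continuous_on UNIV (\<lambda>x. - u x r)"
      by (intro continuous_on_minus smooth_st_continuous_slice[OF u r])
    show "dt T ell x r + adv (\<lambda>y. u y r) (\<lambda>y. ell y r) x - \<nu> *\<^sub>R lap (\<lambda>y. ell y r) x = - u x r" for x
      using l_eq[rule_format, OF r, of x] by (simp add: eq_neg_iff_add_eq_0)
  qed (use incompr r in auto)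
  have V'_le: "V' r \<le> T * M + V r / T" if r: "r \<in> {0..T}" for r
  proof -
    note cu = smooth_st_continuous_slice[OF u r] and cl = smooth_st_continuous_slice[OF l r]
    \<comment> \<open>The weight \<open>T\<close> gives \<open>V\<close> the growth rate
      \<open>1 / T\<close>. The dissipation of \<open>ell\<close> is nonnegative and is dropped
      afterwards.\<close>
    have young: "2 * (a \<bullet> - b) \<le> T * (norm b)\<^sup>2 + (norm a)\<^sup>2 / T" for a b :: "real^3"
    proof -
      have "2 * (a \<bullet> - b) \<le> 2 * (norm a * norm b)"
        using norm_cauchy_schwarz[of a "- b"] by simp
      moreover have "T * (norm b)\<^sup>2 + (norm a)\<^sup>2 / T - 2 * (norm a * norm b) = (T * norm b - norm a)\<^sup>2 / T"
        using T by (simp add: field_simps power2_eq_square)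
      moreover have "(T * norm b - norm a)\<^sup>2 / T \<ge> 0" using T by simp
      ultimately show ?thesis by linarith
    qed
    have h1: "((\<lambda>x. 2 * (ell x r \<bullet> - u x r)) has_integral 2 * integral (cell L) (\<lambda>x. ell x r \<bullet> - u x r)) (cell L)"
      by (intro has_integral_mult_right has_integral_cell continuous_on_inner continuous_on_minus cu cl)
    have h2: "((\<lambda>x. T * (norm (u x r))\<^sup>2 + (norm (ell x r))\<^sup>2 / T) has_integral T * U r + V r / T) (cell L)"
      unfolding U_def V_def
      by (intro has_integral_add has_integral_mult_right has_integral_divide has_integral_cell
          continuous_on_power continuous_on_norm cu cl)
    have "2 * integral (cell L) (\<lambda>x. ell x r \<bullet> - u x r) \<le> T * U r + V r / T"
      by (rule has_integral_le[OF h1 h2 young])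
    moreover have "2 * \<nu> * Dl r \<ge> 0" using nu D0 by simp
    moreover have "T * U r \<le> T * M" using T U_le[OF r] by (intro mult_left_mono) auto
    ultimately show ?thesis unfolding V'_def by linarith
  qed
  \<comment> \<open>The equation \<open>V' = T * M + V / T\<close> has the constant solution
    \<open>- T\<^sup>2 * M\<close>. Measured from it, \<open>V\<close> satisfies a homogeneous
    inequality of rate \<open>1 / T\<close>, which the exponential factor integrates.\<close>
  define H where "H r = (V r + T\<^sup>2 * M) * exp (- r / T)" for r
  have "H T \<le> H 0"
  proof (rule nonincreasing_within[of 0 T H "\<lambda>r. (V' r - (T * M + V r / T)) * exp (- r / T)"])
    fix r assume r: "r \<in> {0..T}"
    have "((\<lambda>r. - r / T) has_real_derivative - 1 / T) (at r within {0..T})"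
      by (intro DERIV_cdivide DERIV_minus DERIV_ident)
    from DERIV_mult[OF DERIV_add[OF dV[OF r] DERIV_const[of "T\<^sup>2 * M"]] DERIV_chain2[OF DERIV_exp this]]
    have "(H has_real_derivative V' r * exp (- r / T) + exp (- r / T) * (- 1 / T) * (V r + T\<^sup>2 * M))
        (at r within {0..T})"
      unfolding H_def[abs_def] by simp
    moreover have "V' r * exp (- r / T) + exp (- r / T) * (- 1 / T) * (V r + T\<^sup>2 * M)
        = (V' r - (T * M + V r / T)) * exp (- r / T)"
    proof -
      have "1 / T * (V r + T\<^sup>2 * M) = T * M + V r / T"
        using T by (simp add: field_simps power2_eq_square)
      moreover have "a * e + e * (- 1 / T) * b = (a - 1 / T * b) * e" for a b e :: real
        by (simp add: algebra_simps)
      ultimately show ?thesis by (simp only:)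
    qed
    ultimately show "(H has_real_derivative (V' r - (T * M + V r / T)) * exp (- r / T)) (at r within {0..T})"
      by (simp only:)
    show "(V' r - (T * M + V r / T)) * exp (- r / T) \<le> 0"
      using V'_le[OF r] by (simp add: mult_nonpos_nonneg)
  qed (use T in auto)
  moreover have "V 0 = 0" using l_init by (simp add: V_def)
  ultimately have "(V T + T\<^sup>2 * M) * exp (- 1) \<le> T\<^sup>2 * M"
    using T by (simp add: H_def)
  then have "V T + T\<^sup>2 * M \<le> T\<^sup>2 * M * exp 1"
    by (simp add: exp_minus field_simps)
  moreover have "T\<^sup>2 * M * exp 1 \<le> T\<^sup>2 * M * 3"
  proof (rule mult_left_mono[OF exp_le])
    \<comment> \<open>Replacing the number e by 3 inside the product requires
      \<open>M \<ge> 0\<close>, which follows since \<open>M\<close> bounds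
      \<open>U 0\<close>.\<close>
    have "U 0 \<ge> 0"
      unfolding U_def by (rule int0) simp
    then have "M \<ge> 0" using U_le[of 0] T by simp
    then show "0 \<le> T\<^sup>2 * M" by simp
  qed
  ultimately have V_le: "V T \<le> 2 * (T\<^sup>2 * M)" by linarith
  have "pair_dispersion L \<delta>0 (\<lambda>x. x + ell x T) \<le> 3 * \<delta>0\<^sup>2 + 6 / L ^ 3 * V T"
    unfolding V_def
    by (rule pair_dispersion_le[OF L smooth_st_continuous_slice[OF l]]) (use T in auto)
  also have "\<dots> \<le> 3 * \<delta>0\<^sup>2 + 6 / L ^ 3 * (2 * (T\<^sup>2 * M))"
    using L by (intro add_left_mono mult_left_mono V_le) auto
  also have "\<dots> = 3 * \<delta>0\<^sup>2 + 24 * (1 / (2 * L ^ 3) * U 0) * T\<^sup>2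
      + 6 * (1 / (\<nu> * T) * (1 / L ^ 3 * integral {0..T} G)) * T ^ 3"
    unfolding M_def using T L nu by (simp add: field_simps power2_eq_square power3_eq_cube)
  also have "1 / L ^ 3 * integral {0..T} G = integral {0..T} (\<lambda>s. 1 / L ^ 3 * G s)"
    by simp
  finally show ?thesis unfolding U_def G_def .
qed

end
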